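(* Let $G$ be a connected reduced proper interval graph with straight ordering $v_1,\dots,v_n$. Then $G$ has a locally complete 2-edge-colouring if and only if one of the following holds: (1) $G$ has no cutvertex, in which case either $cc(G)=1$ or $G$ is of one of the types 1, 2, 3, 4. (2) $v_{j_1},v_{j_2},\dots,v_{j_c}$ are the cutvertices of $G$, where $1<j_1<j_2<\cdots<j_c<n$, and - $cc(G[1,j_1])=1$, or $cc(G[1,j_1])=2$ and $G[1,j_1]$ is of type 1, or $G[1,j_1]$ is of type 2 or 4; - $cc(G[j_c,n])=1$, or $cc(G[j_c,n])=2$ and $G[j_c,n]$ is of type 1, or $G[j_c,n]$ is of type 3 or 4; and - for each $i=1,2,\dots,c-1$, either $cc(G[j_i,j_{i+1}])=1$ or $G[j_i,j_{i+1}]$ is of type 4.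
   Context: All graphs are simple. A 2-edge-colouring $E(G)\to\{1,2\}$ (not necessarily proper) is locally complete if for each vertex $v$ and each colour $c$, the vertices joined to $v$ by edges of colour $c$ induce a complete subgraph of $G$ (equivalently, there is no monochromatic induced path with two edges). A graph is reduced if no two distinct vertices have the same closed neighbourhood. A proper interval graph is the intersection graph of a family of intervals on a line, none properly contained in another. $cc(G)$ is the minimum number of cliques whose union covers $V(G)$. A straight ordering of $G$ is a linear ordering $v_1,\dots,v_n$ of $V(G)$ such that each closed neighbourhood $N[v_i]$ is a set of consecutive vertices $\{v_{i-\ell(i)},\dots,v_i,\dots,v_{i+\gamma(i)}\}$, with $\ell(i),\gamma(i)\ge 0$. Write $\ell(v_i)=v_{i-\ell(i)}$ and $\gamma(v_i)=v_{i+\gamma(i)}$. (A graph is a proper interval graph iff it has a straight ordering.) $G[i,j]$ denotes the subgraph induced by $v_i,\dots,v_j$. Canonical clique covering and types. Let $B$ be a 2-connected reduced proper interval graph with straight ordering $v_1,\dots,v_m$ and $k=cc(B)\ge 2$. The canonical clique covering of $B$ consists of the maximal cliques $B[s_i,t_i]$, $1\le i\le k$, where $t_i$ is the largest integer with $cc(B[1,t_i])=i$ (so $v_{s_i}=\ell(v_{t_i})$). $B$ is of - type 1 if $t_1=s_2$, $t_{k-1}=s_k$ and $t_i=s_{i+1}-1$ for all $2\le i\le k-2$; - type 2 if $k\ge3$, $t_1=s_2$ and $t_i=s_{i+1}-1$ for all $2\le i\le k-1$; - type 3 if $k\ge3$, $t_{k-1}=s_k$ and $t_i=s_{i+1}-1$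 for all $1\le i\le k-2$; - type 4 if $t_i=s_{i+1}-1$ for all $1\le i\le k-1$; where in all types it is also required that for each $i$ with $2\le i\le k-1$, if $\gamma(v_{s_i-1})=v_a$ and $\ell(v_{t_i+1})=v_b$, then $a<b$. The types of the subgraphs $G[i,j]$ in the claim are taken with respect to the ordering inherited from $v_1,\dots,v_n$.
   Formalization: The types 1–4 are defined without requiring B to be reduced, since a block G[i,j] of a reduced G may contain twins (a cutvertex and another vertex); requiring reducedness of the blocks would make the claim false. *)

theory Defs
  imports "HOL-Analysis.Analysis"
begin

record 'a graph =
  verts :: "'a set"
  edges :: "'a set set"

definition simple_graph :: "'a graph \<Rightarrow> bool" where
  "simple_graph G \<longleftrightarrow>
     finite (verts G) \<and> (\<forall>e\<in>edges G. e \<subseteq> verts G \<and> card e = 2)"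

definition induced :: "'a graph \<Rightarrow> 'a set \<Rightarrow> 'a graph" where
  "induced G S = \<lparr>verts = verts G \<inter> S, edges = {e \<in> edges G. e \<subseteq> S}\<rparr>"

definition closed_nbhd :: "'a graph \<Rightarrow> 'a \<Rightarrow> 'a set" where
  "closed_nbhd G x = insert x {y \<in> verts G. {x, y} \<in> edges G}"

definition reduced_graph :: "'a graph \<Rightarrow> bool" where
  "reduced_graph G \<longleftrightarrow>
     (\<forall>x\<in>verts G. \<forall>y\<in>verts G. x \<noteq> y \<longrightarrow> closed_nbhd G x \<noteq> closed_nbhd G y)"

definition clique :: "'a graph \<Rightarrow> 'a set \<Rightarrow> bool" where
  "clique G K \<longleftrightarrow> K \<subseteq> verts G \<and> (\<forall>x\<in>K. \<forall>y\<in>K. x \<noteq> y \<longrightarrow> {x, y} \<in> edges G)"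

definition cc :: "'a graph \<Rightarrow> nat" where
  "cc G = (LEAST k. \<exists>C. finite C \<and> card C = k \<and> (\<forall>K\<in>C. clique G K) \<and> \<Union>C = verts G)"

definition connection :: "'a graph \<Rightarrow> ('a \<times> 'a) set" where
  "connection G = {(x, y). x \<in> verts G \<and> y \<in> verts G \<and> (x, y) \<in> {(a, b). {a, b} \<in> edges G}\<^sup>*}"

definition components :: "'a graph \<Rightarrow> 'a set set" where
  "components G = verts G // connection G"

definition connected_graph :: "'a graph \<Rightarrow> bool" where
  "connected_graph G \<longleftrightarrow> verts G \<noteq> {} \<and> connection G = verts G \<times> verts G"

definition cutvertex :: "'a graph \<Rightarrow> 'a \<Rightarrow> bool" where
  "cutvertex G x \<longleftrightarrow>
     x \<in> verts G \<and> card (components (induced G (verts G - {x}))) > card (components G)"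

definition two_connected :: "'a graph \<Rightarrow> bool" where
  "two_connected G \<longleftrightarrow>
     card (verts G) \<ge> 3 \<and> connected_graph G \<and> (\<forall>x\<in>verts G. \<not> cutvertex G x)"

text \<open>Intervals may be open, closed, half-open or unbounded, and different vertices
  may share the same interval.\<close>

definition proper_interval_graph :: "'a graph \<Rightarrow> bool" where
  "proper_interval_graph G \<longleftrightarrow> simple_graph G \<and>
     (\<exists>I :: 'a \<Rightarrow> real set.
        (\<forall>x\<in>verts G. is_interval (I x) \<and> I x \<noteq> {}) \<and>
        (\<forall>x\<in>verts G. \<forall>y\<in>verts G. x \<noteq> y \<longrightarrow> ({x, y} \<in> edges G \<longleftrightarrow> I x \<inter> I y \<noteq> {})) \<and>
        (\<forall>x\<in>verts G. \<forall>y\<in>verts G. \<not> I x \<subset> I y))"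

definition locally_complete_colouring :: "'a graph \<Rightarrow> ('a set \<Rightarrow> nat) \<Rightarrow> bool" where
  "locally_complete_colouring G col \<longleftrightarrow>
     (\<forall>e\<in>edges G. col e \<in> {1, 2}) \<and>
     (\<forall>x\<in>verts G. \<forall>k\<in>{1, 2}.
        clique G {y \<in> verts G. {x, y} \<in> edges G \<and> col {x, y} = k})"

text \<open>Vertices are enumerated from 1; values of \<open>v\<close> outside \<open>{1..n}\<close> are irrelevant.\<close>

definition straight_ordering :: "'a graph \<Rightarrow> nat \<Rightarrow> (nat \<Rightarrow> 'a) \<Rightarrow> bool" where
  "straight_ordering G n v \<longleftrightarrow>
     bij_betw v {1..n} (verts G) \<and>
     (\<forall>i\<in>{1..n}. \<exists>a b. 1 \<le> a \<and> a \<le> i \<and> i \<le> b \<and> b \<le> n \<and> closed_nbhd G (v i) = v ` {a..b})"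

text \<open>\<open>leftmost G n v i\<close> and \<open>rightmost G n v i\<close> are the positions of the first and the last
  vertex of the closed neighbourhood of \<open>v i\<close>, that is, the indices of the vertices
  \<open>\<ell>(v i)\<close> and \<open>\<gamma>(v i)\<close>.\<close>

definition leftmost :: "'a graph \<Rightarrow> nat \<Rightarrow> (nat \<Rightarrow> 'a) \<Rightarrow> nat \<Rightarrow> nat" where
  "leftmost G n v i = Min {j \<in> {1..n}. v j \<in> closed_nbhd G (v i)}"

definition rightmost :: "'a graph \<Rightarrow> nat \<Rightarrow> (nat \<Rightarrow> 'a) \<Rightarrow> nat \<Rightarrow> nat" where
  "rightmost G n v i = Max {j \<in> {1..n}. v j \<in> closed_nbhd G (v i)}"

definition segment :: "'a graph \<Rightarrow> (nat \<Rightarrow> 'a) \<Rightarrow> nat \<Rightarrow> nat \<Rightarrow> 'a graph" where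
  "segment G v i j = induced G (v ` {i..j})"

text \<open>The canonical clique covering: its \<open>i\<close>-th clique occupies the positions from
  \<open>cov_s B m v i\<close> to \<open>cov_t B m v i\<close>, for \<open>1 \<le> i \<le> cc B\<close>.\<close>

definition cov_t :: "'a graph \<Rightarrow> nat \<Rightarrow> (nat \<Rightarrow> 'a) \<Rightarrow> nat \<Rightarrow> nat" where
  "cov_t B m v i = Max {t \<in> {1..m}. cc (segment B v 1 t) = i}"

definition cov_s :: "'a graph \<Rightarrow> nat \<Rightarrow> (nat \<Rightarrow> 'a) \<Rightarrow> nat \<Rightarrow> nat" where
  "cov_s B m v i = leftmost B m v (cov_t B m v i)"

text \<open>The requirements common to all four types. Reducedness of \<open>B\<close> is deliberately not
  among them: the types get applied to the blocks of a reduced graph, and such a block need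
  not be reduced, since a cutvertex can have the same closed neighbourhood inside a block as
  another vertex of that block. Demanding it would falsify the theorem: take
  the closed neighbourhoods \<open>123\<close>, \<open>1234\<close>, \<open>123456\<close>, \<open>23456\<close>, \<open>3456\<close>, \<open>34567\<close>, \<open>67\<close>
  of the vertices \<open>1, \<dots>, 7\<close>. This graph is reduced and has a locally complete
  2-edge-colouring, but 5 and 6 are twins in its block on \<open>1, \<dots>, 6\<close>.\<close>

definition typed_block :: "'a graph \<Rightarrow> nat \<Rightarrow> (nat \<Rightarrow> 'a) \<Rightarrow> bool" where
  "typed_block B m v \<longleftrightarrow>
     two_connected B \<and> proper_interval_graph B \<and> straight_ordering B m v \<and> cc B \<ge> 2 \<and>
     (\<forall>i. 2 \<le> i \<and> i \<le> cc B - 1 \<longrightarrow>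
        rightmost B m v (cov_s B m v i - 1) < leftmost B m v (cov_t B m v i + 1))"

definition type1 :: "'a graph \<Rightarrow> nat \<Rightarrow> (nat \<Rightarrow> 'a) \<Rightarrow> bool" where
  "type1 B m v \<longleftrightarrow> typed_block B m v \<and>
     cov_t B m v 1 = cov_s B m v 2 \<and>
     cov_t B m v (cc B - 1) = cov_s B m v (cc B) \<and>
     (\<forall>i. 2 \<le> i \<and> i \<le> cc B - 2 \<longrightarrow> cov_t B m v i = cov_s B m v (i + 1) - 1)"

definition type2 :: "'a graph \<Rightarrow> nat \<Rightarrow> (nat \<Rightarrow> 'a) \<Rightarrow> bool" where
  "type2 B m v \<longleftrightarrow> typed_block B m v \<and> cc B \<ge> 3 \<and>
     cov_t B m v 1 = cov_s B m v 2 \<and>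
     (\<forall>i. 2 \<le> i \<and> i \<le> cc B - 1 \<longrightarrow> cov_t B m v i = cov_s B m v (i + 1) - 1)"

definition type3 :: "'a graph \<Rightarrow> nat \<Rightarrow> (nat \<Rightarrow> 'a) \<Rightarrow> bool" where
  "type3 B m v \<longleftrightarrow> typed_block B m v \<and> cc B \<ge> 3 \<and>
     cov_t B m v (cc B - 1) = cov_s B m v (cc B) \<and>
     (\<forall>i. 1 \<le> i \<and> i \<le> cc B - 2 \<longrightarrow> cov_t B m v i = cov_s B m v (i + 1) - 1)"

definition type4 :: "'a graph \<Rightarrow> nat \<Rightarrow> (nat \<Rightarrow> 'a) \<Rightarrow> bool" where
  "type4 B m v \<longleftrightarrow> typed_block B m v \<and>
     (\<forall>i. 1 \<le> i \<and> i \<le> cc B - 1 \<longrightarrow> cov_t B m v i = cov_s B m v (i + 1) - 1)"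

text \<open>A property of ordered graphs, such as a type, for the subgraph induced by
  \<open>v i, \<dots>, v j\<close> with the inherited ordering, re-indexed to start at 1.\<close>

definition segment_has ::
  "('a graph \<Rightarrow> nat \<Rightarrow> (nat \<Rightarrow> 'a) \<Rightarrow> bool) \<Rightarrow> 'a graph \<Rightarrow> (nat \<Rightarrow> 'a) \<Rightarrow> nat \<Rightarrow> nat \<Rightarrow> bool" where
  "segment_has P G v i j \<longleftrightarrow> P (segment G v i j) (j + 1 - i) (\<lambda>k. v (i + k - 1))"

end

theory Submission
  imports Defs
begin

text \<open>The constraints of a locally complete colouring concern edges \<open>ij\<close> and \<open>jk\<close> with
  \<open>i < j < k\<close> and \<open>i\<close>, \<open>k\<close> not adjacent: their colours must differ. If the closed neighbourhood
  of \<open>z\<close> is not a clique, this makes all edges to the left of \<open>z\<close>, except those whose left end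
  sees the whole right neighbourhood, share one colour \<open>f z\<close>; and \<open>f i \<noteq> f j\<close> for any two such
  adjacent vertices with \<open>L i < L j\<close> and \<open>R i < R j\<close>. Running the greedy clique covering
  from left to right and using these inequalities, each clique is forced to start right after the
  preceding one, and no vertex of it can see both the preceding and the following clique; the only
  freedom is an overlap in one vertex at the very beginning or the very end of the graph.

  Conversely, colour the edges inside the cliques of a covering by one colour and the edges between
  them by the other, and exchange the two colours at every cut vertex. An overlap at the beginning is
  resolved by giving the shared vertex to the second clique.\<close>

section \<open>Straight orderings\<close>

text \<open>Reducedness does not pass to blocks, since twins of a block may differ only outside it.
  Necessity is therefore argued on positions of the whole graph, and only the coverings are cut down
  to blocks. Reducedness acts at one point: on a run of vertices with equal \<open>L\<close>,
  \<open>R\<close> is strictly increasing. Hence the last vertex \<open>t\<close> of a clique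
  reaches a vertex \<open>R t\<close> whose first neighbour is exactly \<open>t\<close>, and a
  failure of the desired structure produces three vertices with pairwise different values of
  \<open>f\<close>, impossible with two colours. A clique with something to its left has a witness
  for this, its first vertex, which forces \<open>f\<close> to be constant on the vertices that see
  the next clique. The first clique of the graph has no such witness, and at the other end the
  vertex \<open>n\<close> has a clique as closed neighbourhood, so that no inequality applies to it.
  These are the two places where an overlap survives. A cut vertex at the left end of a block
  supplies the missing witness.\<close>

locale straight_order =
  fixes n :: nat and R L :: "nat \<Rightarrow> nat"
  assumes n_pos: "1 \<le> n"
    and L_ge: "1 \<le> i \<Longrightarrow> i \<le> n \<Longrightarrow> 1 \<le> L i"
    and L_le: "1 \<le> i \<Longrightarrow> i \<le> n \<Longrightarrow> L i \<le> i"
    and R_ge: "1 \<le> i \<Longrightarrow> i \<le> n \<Longrightarrow> i \<le> R i"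
    and R_le: "1 \<le> i \<Longrightarrow> i \<le> n \<Longrightarrow> R i \<le> n"
    and adj_iff: "1 \<le> i \<Longrightarrow> i \<le> j \<Longrightarrow> j \<le> n \<Longrightarrow> L j \<le> i \<longleftrightarrow> j \<le> R i"
begin

lemma R_mono: assumes "1 \<le> i" "i \<le> j" "j \<le> n" shows "R i \<le> R j"
proof (cases "j \<le> R i")
  case True
  have "L (R i) \<le> i" using adj_iff[of i "R i"] assms R_ge[of i] R_le[of i] by simp
  then show ?thesis using adj_iff[of j "R i"] True assms R_le[of i] by simp
next
  case False
  then show ?thesis using R_ge[of j] assms by simp
qed

lemma L_mono: assumes "1 \<le> i" "i \<le> j" "j \<le> n" shows "L i \<le> L j"
proof (cases "L j \<le> i")
  case True
  have "j \<le> R (L j)" using adj_iff[of "L j" j] assms L_ge[of j] L_le[of j] by simp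
  then show ?thesis using adj_iff[of "L j" i] True assms L_ge[of j] by simp
next
  case False
  then show ?thesis using L_le[of i] assms by simp
qed

lemma L_less_iff: assumes "1 < i" "i \<le> j" "j \<le> n" shows "L j < i \<longleftrightarrow> j \<le> R (i - 1)"
proof -
  have "1 \<le> i - 1" "i - 1 \<le> j" using assms by auto
  then show ?thesis using adj_iff[of "i - 1" j] assms by auto
qed

lemma le_L_iff: assumes "1 < i" "i \<le> j" "j \<le> n" shows "i \<le> L j \<longleftrightarrow> R (i - 1) < j"
  using L_less_iff[OF assms] by auto

text \<open>Positional form of a cutvertex (\<open>cutvertex_iff\<close>): as \<open>R\<close> is
  monotone, no vertex before \<open>x\<close> sees past \<open>x\<close>.\<close>

definition cut :: "nat \<Rightarrow> bool" where
  "cut x \<longleftrightarrow> 1 < x \<and> x < n \<and> R (x - 1) = x"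

text \<open>\<open>greedy x i\<close> is the last position of the \<open>i\<close>-th clique of the greedy covering that starts
  at \<open>x\<close>. Once the end of the graph is reached it keeps growing, which makes it strictly monotone
  in \<open>i\<close>.\<close>

primrec greedy :: "nat \<Rightarrow> nat \<Rightarrow> nat" where
  "greedy x 0 = x - 1"
| "greedy x (Suc i) = (if greedy x i < n then R (greedy x i + 1) else greedy x i + 1)"

lemma greedy_less: "greedy x i < greedy x (Suc i)"
  using R_ge[of "greedy x i + 1"] by auto

lemma greedy_strict_mono: "strict_mono (greedy x)"
  by (rule strict_mono_Suc_iff[THEN iffD2]) (simp only: greedy_less simp_thms)

text \<open>The clique covering number of the segment from \<open>x\<close> to \<open>y\<close>, by
  \<open>cc_segment\<close>.\<close>

definition width :: "nat \<Rightarrow> nat \<Rightarrow> nat" where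
  "width x y = (LEAST i. y \<le> greedy x i)"

lemma le_greedy_width: "y \<le> greedy x (width x y)"
  unfolding width_def by (rule LeastI[of _ y]) (rule strict_mono_imp_increasing[OF greedy_strict_mono])

lemma le_greedy_iff: "y \<le> greedy x i \<longleftrightarrow> width x y \<le> i"
proof
  assume "y \<le> greedy x i" then show "width x y \<le> i" unfolding width_def by (rule Least_le)
next
  assume "width x y \<le> i"
  then have "greedy x (width x y) \<le> greedy x i" by (simp add: greedy_strict_mono strict_mono_less_eq)
  then show "y \<le> greedy x i" using le_greedy_width[of y x] by linarith
qed

lemma width_pos: assumes "1 \<le> x" "x \<le> y" shows "1 \<le> width x y"
  using le_greedy_iff[of y x 0] assms by (cases "width x y") auto

text \<open>On a block these are \<open>cov_t\<close> and, with \<open>clique_start\<close>,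
  \<open>cov_s\<close>, in positions of the whole graph. \<open>greedy\<close> and \<open>L\<close>
  are computed in the whole graph, so they are capped at the ends of the segment.\<close>

definition clique_end :: "nat \<Rightarrow> nat \<Rightarrow> nat \<Rightarrow> nat" where
  "clique_end x y i = min (greedy x i) y"

definition clique_start :: "nat \<Rightarrow> nat \<Rightarrow> nat \<Rightarrow> nat" where
  "clique_start x y i = max (L (clique_end x y i)) x"

text \<open>One condition for all the types: consecutive cliques are disjoint, except that a
  junction next to an end of the graph may be an overlap in one vertex. \<open>good_iff\<close>
  sorts it into types.\<close>

definition good :: "nat \<Rightarrow> nat \<Rightarrow> bool" where
  "good x y \<longleftrightarrow> width x y = 1 \<or>
     width x y \<ge> 2 \<and>
     (\<forall>i. 2 \<le> i \<and> i \<le> width x y - 1 \<longrightarrow>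
        R (clique_start x y i - 1) < L (clique_end x y i + 1)) \<and>
     (\<forall>i. 1 \<le> i \<and> i \<le> width x y - 1 \<longrightarrow>
        clique_end x y i = clique_start x y (i + 1) - 1 \<or>
        clique_end x y i = clique_start x y (i + 1) \<and>
          (i = 1 \<and> x = 1 \<or> i = width x y - 1 \<and> y = n))"

text \<open>Because of \<open>x < y\<close>, the graph with one vertex has no block in this sense;
  the theorem treats it separately.\<close>

definition block :: "nat \<Rightarrow> nat \<Rightarrow> bool" where
  "block x y \<longleftrightarrow> 1 \<le> x \<and> x < y \<and> y \<le> n \<and> (x = 1 \<or> cut x) \<and> (y = n \<or> cut y) \<and>
     (\<forall>z. x < z \<and> z < y \<longrightarrow> \<not> cut z)"

text \<open>Colours are Booleans, so that two values different from a third are equal without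
  further case analysis.\<close>

definition alternating :: "(nat \<Rightarrow> nat \<Rightarrow> bool) \<Rightarrow> bool" where
  "alternating c \<longleftrightarrow> (\<forall>i j k. 1 \<le> i \<and> i < j \<and> j < k \<and> k \<le> n \<and> j \<le> R i \<and> k \<le> R j \<and> R i < k
      \<longrightarrow> c i j \<noteq> c j k)"

end

locale connected_straight_order = straight_order +
  assumes R_gt: "1 \<le> i \<Longrightarrow> i < n \<Longrightarrow> i < R i"
begin

lemma L_lt: assumes "1 < i" "i \<le> n" shows "L i < i"
proof -
  have "i - 1 < R (i - 1)" by (rule R_gt) (use assms in auto)
  then show ?thesis using L_less_iff[of i i] assms by simp
qed

lemma cut_R: assumes "cut x" "1 \<le> i" "i < x" shows "R i \<le> x"
proof -
  have "x < n" using assms(1) unfolding cut_def by simp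
  then have "R i \<le> R (x - 1)" by (intro R_mono) (use assms(2,3) in linarith)+
  then show ?thesis using assms(1) unfolding cut_def by simp
qed

lemma cut_L: assumes "cut x" "x < i" "i \<le> n" shows "x \<le> L i"
  using assms le_L_iff[of x i] unfolding cut_def by simp

lemma block_R: assumes "block x y" "x \<le> i" "i < y" shows "R i \<le> y"
  using assms cut_R[of y i] R_le[of i] unfolding block_def by auto

lemma block_L: assumes "block x y" "x < i" "i \<le> y" shows "x \<le> L i"
  using assms cut_L[of x i] L_ge[of i] unfolding block_def by auto

lemma not_cut_R: assumes "1 < x" "x < n" "\<not> cut x" shows "x + 1 \<le> R (x - 1)"
proof -
  have "x - 1 < R (x - 1)" by (rule R_gt) (use assms in auto)
  then show ?thesis using assms unfolding cut_def by auto
qed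

end

section \<open>Necessity\<close>

locale reduced_straight_order = connected_straight_order +
  assumes twin_free: "1 \<le> i \<Longrightarrow> i \<le> n \<Longrightarrow> 1 \<le> j \<Longrightarrow> j \<le> n \<Longrightarrow> L i = L j \<Longrightarrow> R i = R j \<Longrightarrow> i = j"
begin

text \<open>The vertices whose closed neighbourhood is not a clique.\<close>

definition central :: "nat \<Rightarrow> bool" where
  "central z \<longleftrightarrow> 1 \<le> z \<and> z \<le> n \<and> R (L z) < R z"

lemma centralI: assumes "1 \<le> z" "z \<le> n" "L z \<le> i" "1 \<le> i" "i \<le> n" "R i < R z" shows "central z"
  using assms R_mono[of "L z" i] L_ge[of z] unfolding central_def by simp

text \<open>This is \<open>f i \<noteq> f j\<close> for \<open>f z = c (L z) z\<close>. The path
  \<open>L i\<close>, \<open>i\<close>, \<open>j\<close>, \<open>R j\<close> and the path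
  \<open>L j\<close>, \<open>j\<close>, \<open>R j\<close> give a chain of three inequalities
  between Booleans, whose ends therefore differ. Necessity uses the colouring only through this
  lemma.\<close>

lemma central_adjacent:
  assumes c: "alternating c" and i: "central i" and j: "central j"
    and ij: "i < j" "j \<le> R i" "L i < L j" "R i < R j"
  shows "c (L i) i \<noteq> c (L j) j"
proof -
  have b: "1 \<le> i" "j \<le> n" "i \<le> n" "1 \<le> j" using i j ij unfolding central_def by auto
  have Li: "L i < i" using i L_le[of i] b unfolding central_def by (cases "L i = i") auto
  have Lj: "L j < j" using j L_le[of j] b unfolding central_def by (cases "L j = j") auto
  have Rj: "j < R j" using ij by simp
  have "\<not> j \<le> R (L i)" using adj_iff[of "L i" j] ij b L_ge[of i] L_le[of i] by simp
  then have 1: "c (L i) i \<noteq> c i j"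
    using c[unfolded alternating_def, rule_format, of "L i" i j] L_ge[of i] b Li ij adj_iff[of "L i" i] by simp
  have 2: "c i j \<noteq> c j (R j)"
    using c[unfolded alternating_def, rule_format, of i j "R j"] ij b Rj R_le[of j] by simp
  have 3: "c (L j) j \<noteq> c j (R j)"
    using c[unfolded alternating_def, rule_format, of "L j" j "R j"] b Rj Lj R_le[of j] L_ge[of j]
      adj_iff[of "L j" j] j unfolding central_def by simp
  show ?thesis using 1 2 3 by auto
qed

text \<open>The invariant of the greedy covering, for the last position \<open>t\<close> of a clique: no vertex of
  that clique has neighbours on both sides of it.\<close>

definition separated :: "nat \<Rightarrow> bool" where
  "separated t \<longleftrightarrow> 1 \<le> t \<and> t < n \<and> 1 < L t \<and> R (L t) = t \<and> R (L t - 1) < L (t + 1)"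

text \<open>Starts the invariant afresh in a block that begins at a cut vertex: what lies before
  \<open>x\<close> sees at most \<open>x\<close>, and \<open>x\<close> does not see past
  \<open>R x\<close>.\<close>

lemma separated_cut: assumes "cut x" "R x < n" shows "separated (R x)"
proof -
  have x: "1 < x" "x < n" "R (x - 1) = x" using assms unfolding cut_def by auto
  have "x < R x" using R_gt[of x] x by simp
  then have "L (R x) = x"
    using cut_L[OF assms(1), of "R x"] adj_iff[of x "R x"] x assms(2) by simp
  moreover have "x < L (R x + 1)" using adj_iff[of x "R x + 1"] x assms(2) R_ge[of x] by (simp add: not_le[symmetric])
  ultimately show ?thesis unfolding separated_def using x assms(2) \<open>x < R x\<close> by simp
qed

text \<open>The current clique is \<open>s..t\<close> with \<open>s = L t\<close>, and
  \<open>p\<close> starts the next one. On the vertices that see \<open>p\<close>, \<open>f\<close>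
  is opposite to \<open>f s\<close>, hence constant, and \<open>f p\<close> is opposite to this
  constant. A vertex \<open>R t\<close> that saw past \<open>R p\<close> would have to differ from
  both. The first alternative is the overlap in \<open>t\<close> at the right end of the
  graph.\<close>

lemma progress:
  assumes c: "alternating c" and t: "separated t" and nc: "\<not> cut t"
  defines "p \<equiv> t + 1"
  shows "p < R t \<and> (R t = n \<and> R p = n \<and> L n = t \<or>
     R t < R p \<and> L (R p) = p \<and> (R p < n \<longrightarrow> separated (R p)))"
proof -
  define s b u where "s = L t" and "b = L p" and "u = R p"
  have s: "t < n" "1 < s" "R s = t" "R (s - 1) < b"
    using t unfolding separated_def s_def b_def p_def by auto
  have "s \<le> t" using t L_le[of t] unfolding separated_def s_def by simp
  then have tn: "1 < t" "s \<le> t" using s(2) by linarith+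
  have st: "s < t" using L_lt[of t] tn s s_def by simp
  have p: "1 \<le> p" "p \<le> n" "1 \<le> t" using s tn unfolding p_def by auto
  have bt: "b < t" using not_cut_R[OF tn(1) s(1) nc] L_less_iff[of t p] tn p
    unfolding b_def p_def by simp
  have sb: "s < b" using adj_iff[of s p] s st p unfolding b_def p_def by (simp add: not_le[symmetric])
  have Ls: "L s < s" using L_lt[of s] s st by simp
  \<comment> \<open>By the invariant, a vertex of the clique that sees \<open>p\<close> does not see
    \<open>s - 1\<close>.\<close>
  have Lz: "L z = s" if "b \<le> z" "z \<le> t" for z
  proof -
    have "s \<le> L z" using le_L_iff[of s z] s that sb by auto
    moreover have "L z \<le> s" using adj_iff[of s z] that sb s by auto
    ultimately show ?thesis by simp
  qed
  have Rz: "p \<le> R z" if "b \<le> z" "z \<le> t" for z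
    using adj_iff[of z p] that sb s p unfolding b_def p_def by simp
  \<comment> \<open>These vertices agree in \<open>L\<close>, so equal values of \<open>R\<close>
    would make them twins.\<close>
  have Rstrict: "R z < R z'" if "b \<le> z" "z < z'" "z' \<le> t" for z z'
    using R_mono[of z z'] twin_free[of z z'] Lz[of z] Lz[of z'] that sb s by (cases "R z = R z'") auto
  have "R (L s) \<le> R (s - 1)" by (intro R_mono) (use L_ge[of s] Ls s(1,2) st in linarith)+
  then have cs: "central s" using s st bt L_ge[of s] unfolding central_def by simp
  have cz: "central z" if "b \<le> z" "z \<le> t" for z
    using centralI[of z s] Rz[OF that] Lz[OF that] that sb s p_def by simp
  have fz: "c (L s) s \<noteq> c (L z) z" if "b \<le> z" "z \<le> t" for z
    using central_adjacent[OF c cs cz[OF that]] that sb s Ls Lz[OF that] Rz[OF that] p_def by simp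
  have Rb: "R b < R t" using Rstrict[of b t] bt by simp
  have Rtu: "R t \<le> u" using R_mono[of t p] p unfolding u_def p_def by simp
  have un: "u \<le> n" using R_le[of p] p u_def by simp
  have cp: "central p" using centralI[of p b] p sb s Rb Rtu bt unfolding b_def u_def by simp
  have fp: "c (L b) b \<noteq> c (L p) p"
    using central_adjacent[OF c cz[of b] cp] bt Lz[of b] sb Rz[of b] Rb Rtu
    unfolding b_def u_def p_def by simp
  define w where "w = R t"
  have pw: "p < w" using Rz[of b] Rb bt unfolding w_def by simp
  have wn: "w \<le> n" using R_le[of t] p s unfolding w_def by simp
  \<comment> \<open>\<open>t - 1\<close> also sees \<open>p\<close>, so
    \<open>R (t - 1) < R t = w\<close>.\<close>
  have Lw: "L w = t"
  proof -
    have "L w \<le> t" using adj_iff[of t w] p wn pw unfolding w_def p_def by simp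
    moreover have "t \<le> L w" using le_L_iff[of t w] Rstrict[of "t - 1" t] bt wn pw sb s
      unfolding w_def p_def by simp
    ultimately show ?thesis by simp
  qed
  \<comment> \<open>Otherwise \<open>w\<close> is central, and \<open>t\<close>, \<open>p\<close>,
    \<open>w\<close> have pairwise different values of \<open>f\<close>.\<close>
  have key: "R w \<le> u"
  proof (rule ccontr)
    assume "\<not> R w \<le> u"
    then have uw: "u < R w" by simp
    have cw: "central w" using centralI[of w t] Lw p wn pw uw Rtu s unfolding w_def by simp
    have 1: "c (L t) t \<noteq> c (L w) w"
      using central_adjacent[OF c cz[of t] cw] bt pw Lz[of t] Lw st uw Rtu
      unfolding w_def p_def by simp
    have 2: "c (L p) p \<noteq> c (L w) w"
      using central_adjacent[OF c cp cw pw] Lw bt uw Rtu unfolding w_def b_def u_def by simp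
    show False using 1 2 fp fz[of t] fz[of b] bt by auto
  qed
  show ?thesis
  proof (cases "R t = u")
    case True
    \<comment> \<open>Here \<open>w = u\<close>, so \<open>key\<close> says that \<open>u\<close>
      sees nothing beyond itself; by connectedness it is the last vertex.\<close>
    have "u = n" using key True R_gt[of u] un p pw unfolding w_def by (cases "u = n") auto
    then show ?thesis using True Lw pw unfolding w_def u_def by auto
  next
    case False
    then have lt: "R t < u" using Rtu by simp
    have pu: "p \<le> u" using R_ge[of p] p u_def by simp
    have "\<not> L u \<le> t" using adj_iff[of t u] lt p un pu unfolding p_def by simp
    moreover have "L u \<le> p" using adj_iff[of p u] p un pu u_def by simp
    ultimately have Lu: "L u = p" unfolding p_def by simp
    have "R t < L (u + 1)" if "u < n"
      using adj_iff[of w "u+1"] key that pw lt wn unfolding w_def[symmetric] by (simp add: not_le[symmetric])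
    then have "separated u" if "u < n" using that Lu p tn pu lt unfolding separated_def u_def[symmetric] p_def
      by (auto simp: u_def p_def)
    then show ?thesis using lt Lu pw unfolding w_def u_def by auto
  qed
qed

text \<open>Nothing lies to the left of the first clique, so \<open>f\<close> need not be constant
  on its vertices that see \<open>p\<close>; only those that reach less far than \<open>p\<close>
  are known to be opposite to \<open>p\<close>. This is why \<open>R t = R p\<close>, an overlap in
  \<open>t\<close>, can occur here before the end of the graph.\<close>

lemma progress_first:
  assumes c: "alternating c" and tn: "R 1 < n" and nc: "\<not> cut (R 1)"
  defines "t \<equiv> R 1" and "p \<equiv> R 1 + 1"
  shows "p < R t \<and> (R p < n \<longrightarrow> separated (R p)) \<and>
     (R t = R p \<and> L (R p) = t \<or> R t < R p \<and> L (R p) = p)"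
proof -
  define b u where "b = L p" and "u = R p"
  have t1: "1 < t" using R_gt[of 1] tn R_ge[of 1] t_def by simp
  have p: "1 \<le> p" "p \<le> n" "p = t + 1" "1 \<le> t" "t < n" using tn t1 unfolding p_def t_def by auto
  have bt: "b < t" using not_cut_R[of t] L_less_iff[of t p] t1 p nc
    unfolding b_def t_def by simp
  have sb: "1 < b" using adj_iff[of 1 p] t1 p unfolding b_def t_def by (simp add: not_le[symmetric])
  have Lz: "L z = 1" if "1 \<le> z" "z \<le> t" for z
    using adj_iff[of 1 z] that p L_ge[of z] unfolding t_def by simp
  have Rz: "p \<le> R z" if "b \<le> z" "z \<le> t" for z
    using adj_iff[of z p] that sb p unfolding b_def by simp
  have Rstrict: "R z < R z'" if "1 \<le> z" "z < z'" "z' \<le> t" for z z'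
    using R_mono[of z z'] twin_free[of z z'] Lz[of z] Lz[of z'] that p by (cases "R z = R z'") auto
  have cz: "central z" if "b \<le> z" "z \<le> t" for z
    using centralI[of z 1] Rz[OF that] Lz[of z] that sb p t_def by simp
  have Rb: "R b < R t" using Rstrict[of b t] bt sb by simp
  have Rtu: "R t \<le> u" using R_mono[of t p] p unfolding u_def by simp
  have un: "u \<le> n" using R_le[of p] p u_def by simp
  have cp: "central p" using centralI[of p b] p sb Rb Rtu bt unfolding b_def u_def by simp
  have fp: "c (L z) z \<noteq> c (L p) p" if "b \<le> z" "z \<le> t" "R z < u" for z
    using central_adjacent[OF c cz[OF that(1,2)] cp] Rz[OF that(1,2)] that Lz[of z] sb p
    unfolding b_def u_def by simp
  define w where "w = R t"
  have pw: "p < w" using Rz[of b] Rb bt unfolding w_def by simp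
  have wn: "w \<le> n" using R_le[of t] p unfolding w_def by simp
  have Lw: "L w = t"
  proof -
    have "L w \<le> t" using adj_iff[of t w] p wn pw unfolding w_def by simp
    moreover have "t \<le> L w" using le_L_iff[of t w] Rstrict[of "t - 1" t] bt wn pw sb p
      unfolding w_def by simp
    ultimately show ?thesis by simp
  qed
  have pu: "p \<le> u" using R_ge[of p] p u_def by simp
  show ?thesis
  proof (cases "R t = u")
    case True
    have "separated u" if un': "u < n"
    proof -
      have Lu: "L u = t" using True Lw unfolding w_def by simp
      have Ru: "u < R u" using R_gt[of u] un' pu p by simp
      have cu: "central u" using centralI[of u t] Lu True Ru p pu un' by simp
      have ft: "c (L t) t \<noteq> c (L u) u"
        using central_adjacent[OF c cz[of t] cu] bt True p pu Lz[of t] Lu t1 Ru by simp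
      have fu: "c (L p) p \<noteq> c (L u) u"
        using central_adjacent[OF c cp cu] Lu Ru bt pw True unfolding w_def b_def u_def by simp
      have lt: "R (t - 1) < u" using Rstrict[of "t - 1" t] t1 True by simp
      have f': "c (L (t - 1)) (t - 1) \<noteq> c (L p) p" using fp[of "t - 1"] lt bt by simp
      \<comment> \<open>The clique ending at \<open>u\<close> starts at \<open>t\<close>, so the
        invariant for it concerns the reach of \<open>t - 1\<close>. If \<open>w'\<close> saw past
        \<open>u\<close>, then \<open>f t = f p\<close> (both differ from \<open>f u\<close>),
        \<open>f (t - 1) \<noteq> f p\<close>, and \<open>f w'\<close> would differ from both
        \<open>f t\<close> and \<open>f (t - 1)\<close>.\<close>
      define w' where "w' = R (t - 1)"
      have w': "p \<le> w'" "w' \<le> n" "w' < u" using Rz[of "t - 1"] lt un bt unfolding w'_def by auto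
      have "R w' \<le> u"
      proof (rule ccontr)
        assume "\<not> R w' \<le> u"
        then have uw: "u < R w'" by simp
        have Lw': "L w' \<le> t - 1" using L_less_iff[of t w'] w' t1 p w'_def by simp
        have bLw: "1 < L w'" using L_mono[of p w'] w' p sb b_def by simp
        have cw: "central w'" using centralI[of w' "t - 1"] Lw' w' uw lt t1 p unfolding w'_def by simp
        have 1: "c (L t) t \<noteq> c (L w') w'"
          using central_adjacent[OF c cz[of t] cw] bt p w' Lz[of t] bLw True uw by simp
        have 2: "c (L (t - 1)) (t - 1) \<noteq> c (L w') w'"
          using central_adjacent[OF c cz[of "t - 1"] cw] bt p w' Lz[of "t - 1"] bLw lt uw t1
          by (simp add: w'_def)
        show False using 1 2 ft fu f' by auto
      qed
      then have "w' < L (u + 1)" using adj_iff[of w' "u + 1"] w' p un' by (simp add: not_le[symmetric])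
      then show ?thesis using Lu True un' t1 p pu unfolding separated_def w'_def by simp
    qed
    then show ?thesis using True Lw pw unfolding w_def u_def by auto
  next
    case False
    then have lt: "R t < u" using Rtu by simp
    have "\<not> L u \<le> t" using adj_iff[of t u] lt p un pu by simp
    moreover have "L u \<le> p" using adj_iff[of p u] p un pu u_def by simp
    ultimately have Lu: "L u = p" using p by simp
    \<comment> \<open>Now \<open>R t < R p\<close>, so \<open>t\<close> itself is opposite to
      \<open>p\<close>, and the argument of \<open>progress\<close> applies to \<open>t\<close>,
      \<open>p\<close>, \<open>w\<close>.\<close>
    have key: "R w \<le> u"
    proof (rule ccontr)
      assume "\<not> R w \<le> u"
      then have uw: "u < R w" by simp
      have cw: "central w" using centralI[of w t] Lw p wn pw uw Rtu unfolding w_def by simp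
      have 1: "c (L t) t \<noteq> c (L w) w"
        using central_adjacent[OF c cz[of t] cw] bt pw Lz[of t] Lw t1 uw Rtu p
        unfolding w_def by simp
      have 2: "c (L p) p \<noteq> c (L w) w"
        using central_adjacent[OF c cp cw pw] Lw bt uw lt unfolding w_def b_def u_def by simp
      show False using 1 2 fp[of t] bt lt by auto
    qed
    have "R t < L (u + 1)" if "u < n"
      using adj_iff[of w "u+1"] key that pw lt wn unfolding w_def[symmetric] by (simp add: not_le[symmetric])
    then have "separated u" if "u < n" using that Lu p t1 pu unfolding separated_def u_def[symmetric]
      by (simp add: u_def)
    then show ?thesis using lt Lu pw unfolding w_def u_def by auto
  qed
qed

end

section \<open>The greedy covering of a block\<close>

context connected_straight_order
begin

lemma greedy_1: assumes "block x y" shows "greedy x 1 = R x"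
  using assms unfolding block_def by auto

lemma greedy_less_iff: "greedy x i < y \<longleftrightarrow> i < width x y"
  using le_greedy_iff[of y x i] by auto

lemma greedy_gt: assumes "2 \<le> i" "block x y" shows "x < greedy x i"
proof -
  have "greedy x 1 < greedy x i" using assms by (simp only: strict_mono_less[OF greedy_strict_mono])
  moreover have "x \<le> R x" using R_ge[of x] assms(2) unfolding block_def by simp
  ultimately show ?thesis using greedy_1[OF assms(2)] by simp
qed

lemma clique_end_simps:
  "i < width x y \<Longrightarrow> clique_end x y i = greedy x i" "clique_end x y (width x y) = y"
  using greedy_less_iff[of x i y] le_greedy_width[of y x] unfolding clique_end_def by auto

lemma clique_start_eq:
  assumes "block x y" "2 \<le> i"
  shows "clique_start x y i = L (clique_end x y i)"
proof -
  have "x < clique_end x y i" "clique_end x y i \<le> y"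
    using greedy_gt[OF assms(2,1)] assms(1) unfolding clique_end_def block_def by auto
  then show ?thesis using block_L[OF assms(1), of "clique_end x y i"] unfolding clique_start_def by simp
qed

end

context reduced_straight_order
begin

lemma separated_step:
  assumes c: "alternating c" and b: "block x y" and t: "t < y" "x < t" "separated t"
  shows "R (t + 1) \<le> y \<and> (R (t + 1) < n \<longrightarrow> separated (R (t + 1))) \<and>
     (L (R (t + 1)) = t + 1 \<or> L (R (t + 1)) = t \<and> R (t + 1) = n)"
proof -
  have nc: "\<not> cut t" using b t unfolding block_def by simp
  have pr: "t + 1 < R t" "R t = n \<and> R (t + 1) = n \<and> L n = t \<or>
     R t < R (t + 1) \<and> L (R (t + 1)) = t + 1 \<and> (R (t + 1) < n \<longrightarrow> separated (R (t + 1)))"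
    using progress[OF c t(3) nc] by auto
  \<comment> \<open>With \<open>t + 1 < R t\<close> this puts \<open>t + 1\<close> strictly before
    \<open>y\<close>, so that \<open>block_R\<close> applies to it as well.\<close>
  have "R t \<le> y" using block_R[OF b, of t] t by simp
  then have "R (t + 1) \<le> y" using block_R[OF b, of "t + 1"] pr(1) t by simp
  then show ?thesis using pr(2) by auto
qed

text \<open>The bound by \<open>y\<close> says that the greedy covering, although computed in the
  whole graph, never jumps over the end of the block. The induction carries the invariant
  \<open>separated\<close>; it can be missing only after the first clique of the graph, where
  \<open>progress_first\<close> takes over.\<close>

lemma greedy_step:
  assumes c: "alternating c" and b: "block x y"
  shows "1 \<le> i \<Longrightarrow> i < width x y \<Longrightarrow>
     greedy x (i + 1) \<le> y \<and> (greedy x (i + 1) < n \<longrightarrow> separated (greedy x (i + 1))) \<and>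
     (L (greedy x (i + 1)) = greedy x i + 1 \<or>
      L (greedy x (i + 1)) = greedy x i \<and> (i = 1 \<and> x = 1 \<or> greedy x (i + 1) = n))"
proof (induction i)
  case (Suc i)
  define t where "t = greedy x (Suc i)"
  have ty: "t < y" using Suc.prems greedy_less_iff t_def by blast
  have tn: "t < n" using ty b unfolding block_def by simp
  have nxt: "greedy x (Suc i + 1) = R (t + 1)" using tn t_def by simp
  have yn: "y \<le> n" "1 \<le> x" "x < n" using b unfolding block_def by auto
  show ?case
  proof (cases "separated t")
    case True
    have "x < t"
    proof (cases "i = 0")
      case True
      then show ?thesis using R_gt[of x] yn unfolding t_def by simp
    next
      case False
      then show ?thesis using greedy_gt[OF _ b, of "Suc i"] t_def by simp
    qed
    then show ?thesis using separated_step[OF c b ty _ True] nxt t_def by auto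
  next
    case False
    \<comment> \<open>After the first clique the induction hypothesis supplies
      \<open>separated t\<close>, so \<open>t\<close> ends the first clique; then
      \<open>separated_cut\<close> rules out that \<open>x\<close> is a cut vertex.\<close>
    have i0: "i = 0" using Suc False ty yn(1) t_def by (cases "i = 0") auto
    have t: "t = R x" using greedy_1[OF b] i0 unfolding t_def by (simp del: greedy.simps)
    have x: "x = 1" using b separated_cut[of x] False t tn unfolding block_def by auto
    have t1: "t = R 1" "R 1 < n" using t x tn by auto
    have "1 < t" using R_gt[of 1] t1(1) yn x by simp
    then have nc: "\<not> cut (R 1)" using b ty x t1(1) unfolding block_def by simp
    have pr: "t + 1 < R t" "R (t + 1) < n \<longrightarrow> separated (R (t + 1))"
      "L (R (t + 1)) = t \<or> L (R (t + 1)) = t + 1"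
      using progress_first[OF c t1(2) nc] unfolding t1(1)[symmetric] by auto
    have "R t \<le> y" using block_R[OF b, of t] x \<open>1 < t\<close> ty by simp
    then have "R (t + 1) \<le> y" using block_R[OF b, of "t + 1"] pr(1) x by simp
    then show ?thesis using pr i0 x nxt t_def by auto
  qed
qed simp

lemma good_if_alternating:
  assumes c: "alternating c" and b: "block x y"
  shows "good x y"
proof (cases "width x y = 1")
  case False
  define k where "k = width x y"
  have k: "2 \<le> k" using width_pos[of x y] b False unfolding block_def k_def by simp
  \<comment> \<open>The last clique is not truncated: \<open>greedy_step\<close> gives one
    inequality, the definition of \<open>width\<close> the other.\<close>
  have "greedy x k = y"
    using greedy_step[OF c b, of "k - 1"] k le_greedy_width[of y x] unfolding k_def by simp
  then have ce: "clique_end x y i = greedy x i" if "i \<le> k" for i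
    using that clique_end_simps unfolding k_def by (cases "i = width x y") (auto simp: k_def)
  have cs: "clique_start x y i = L (greedy x i)" if "2 \<le> i" "i \<le> k" for i
    using clique_start_eq[OF b that(1)] ce[OF that(2)] by simp
  have 1: "R (clique_start x y i - 1) < L (clique_end x y i + 1)" if i: "2 \<le> i" "i \<le> k - 1" for i
  proof -
    have "greedy x i < y" using greedy_less_iff i k k_def by simp
    then have "greedy x i < n" using b unfolding block_def by simp
    then have "separated (greedy x i)"
      using greedy_step[OF c b, of "i - 1"] i k unfolding k_def by simp
    then show ?thesis using ce[of i] cs[of i] i k unfolding separated_def by simp
  qed
  have 2: "clique_end x y i = clique_start x y (i + 1) - 1 \<or>
        clique_end x y i = clique_start x y (i + 1) \<and> (i = 1 \<and> x = 1 \<or> i = k - 1 \<and> y = n)"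
    if i: "1 \<le> i" "i \<le> k - 1" for i
  proof -
    have ik: "i < k" using i k by simp
    have "greedy x (i + 1) = n \<longrightarrow> i = k - 1 \<and> y = n"
    proof
      assume a: "greedy x (i + 1) = n"
      then have "width x y \<le> i + 1" using le_greedy_iff[of y x "i + 1"] b unfolding block_def by simp
      then show "i = k - 1 \<and> y = n" using greedy_step[OF c b i(1)] ik a b unfolding k_def block_def by auto
    qed
    moreover have "clique_end x y i = greedy x i" "clique_start x y (i + 1) = L (greedy x (i + 1))"
      using ce[of i] cs[of "i + 1"] i ik by auto
    ultimately show ?thesis using greedy_step[OF c b i(1)] ik unfolding k_def
      by (auto simp del: greedy.simps)
  qed
  show ?thesis using 1 2 k unfolding good_def k_def by blast
qed (simp add: good_def)

end

section \<open>Sufficiency\<close>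

context connected_straight_order
begin

text \<open>\<open>P\<close> consists of the last positions of all but the last clique of a covering of the block
  by disjoint cliques; an edge lies inside a clique iff no separator lies between its ends. The last
  two clauses keep all edges at a cut vertex inside cliques.\<close>

definition separators :: "nat \<Rightarrow> nat \<Rightarrow> nat set \<Rightarrow> bool" where
  "separators x y P \<longleftrightarrow> P \<subseteq> {x..<y} \<and>
     (\<forall>i j. x \<le> i \<and> i < j \<and> j \<le> y \<and> P \<inter> {i..<j} = {} \<longrightarrow> j \<le> R i) \<and>
     (\<forall>i j k. x \<le> i \<and> i < j \<and> j < k \<and> k \<le> y \<and> j \<le> R i \<and> k \<le> R j \<and> R i < k \<longrightarrow>
        P \<inter> {i..<j} = {} \<or> P \<inter> {j..<k} = {}) \<and>
     (x \<noteq> 1 \<longrightarrow> P \<inter> {x..<R x} = {}) \<and>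
     (y \<noteq> n \<longrightarrow> P \<inter> {L y..<y} = {})"

text \<open>The cliques are the ranges from \<open>e i + 1\<close> to \<open>e (i + 1)\<close>. The
  hypothesis \<open>R (e i) < L (e (i + 1) + 1)\<close> says that no vertex of such a range sees
  both the preceding and the following one, which prevents both edges \<open>ij\<close> and
  \<open>jk\<close> from crossing separators.\<close>

lemma separators_sequence:
  fixes e :: "nat \<Rightarrow> nat"
  assumes b: "block x y" and e0: "e 0 = x - 1" and ek: "e k = y"
    and mono: "\<And>i. i < k \<Longrightarrow> e i < e (i + 1)"
    and cl: "\<And>i. i < k \<Longrightarrow> e (i + 1) \<le> R (e i + 1)"
    and sep: "\<And>i. 1 \<le> i \<Longrightarrow> i + 1 < k \<Longrightarrow> R (e i) < L (e (i + 1) + 1)"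
    and left: "x \<noteq> 1 \<Longrightarrow> R x \<le> e 1"
    and right: "y \<noteq> n \<Longrightarrow> e (k - 1) < L y"
  shows "separators x y (e ` {1..<k})"
proof -
  have x: "1 \<le> x" "x < y" "y \<le> n" using b unfolding block_def by auto
  have sm: "e i < e j" if "i < j" "j \<le> k" for i j
    using that
  proof (induction j)
    case (Suc j)
    then show ?case using mono[of j] by (cases "i = j") auto
  qed simp
  have sml: "e i \<le> e j" if "i \<le> j" "j \<le> k" for i j
    using sm[of i j] that by (cases "i = j") auto
  \<comment> \<open>The number of the clique that contains \<open>j\<close>.\<close>
  define I where "I j = (LEAST i. j \<le> e i)" for j
  have I: "j \<le> e (I j)" "I j \<le> k" "1 \<le> I j" "e (I j - 1) < j" if "x \<le> j" "j \<le> y" for j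
  proof -
    show 1: "j \<le> e (I j)" unfolding I_def by (rule LeastI[of _ k]) (use that ek in simp)
    show "I j \<le> k" unfolding I_def by (rule Least_le) (use that ek in simp)
    show 2: "1 \<le> I j" using 1 e0 that x by (cases "I j") auto
    show "e (I j - 1) < j" using not_less_Least[of "I j - 1" "\<lambda>i. j \<le> e i"] 2 unfolding I_def[symmetric]
      by (simp add: not_le)
  qed
  show ?thesis
    unfolding separators_def
  proof (intro conjI allI impI)
    show "e ` {1..<k} \<subseteq> {x..<y}"
    proof
      fix p assume "p \<in> e ` {1..<k}"
      then obtain i where "1 \<le> i" "i < k" "p = e i" by auto
      then show "p \<in> {x..<y}" using sm[of 0 i] sm[of i k] e0 ek x by auto
    qed
  next
    fix i j assume a: "x \<le> i \<and> i < j \<and> j \<le> y \<and> e ` {1..<k} \<inter> {i..<j} = {}"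
    have j: "x \<le> j" "j \<le> y" using a by auto
    have "e (I j - 1) < i"
    proof (cases "I j = 1")
      case True
      then show ?thesis using e0 a x by auto
    next
      case False
      then have "e (I j - 1) \<in> e ` {1..<k}" using I(2,3)[OF j] by (intro imageI) auto
      then show ?thesis using a I(4)[OF j] by auto
    qed
    then have "R (e (I j - 1) + 1) \<le> R i" by (intro R_mono) (use a x in auto)
    moreover have "I j - 1 < k" "I j - 1 + 1 = I j" using I(2,3)[OF j] by linarith+
    ultimately show "j \<le> R i" using cl[of "I j - 1"] I(1)[OF j] by auto
  next
    fix i j l
    assume a: "x \<le> i \<and> i < j \<and> j < l \<and> l \<le> y \<and> j \<le> R i \<and> l \<le> R j \<and> R i < l"
    show "e ` {1..<k} \<inter> {i..<j} = {} \<or> e ` {1..<k} \<inter> {j..<l} = {}"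
    proof (rule ccontr)
      assume "\<not> ?thesis"
      then obtain p q where p: "1 \<le> p" "p < k" "i \<le> e p" "e p < j"
        and q: "1 \<le> q" "q < k" "j \<le> e q" "e q < l" by auto
      have j: "x \<le> j" "j \<le> y" using a by auto
      have "p \<le> I j - 1" using sml[of "I j" p] I[OF j] p by (cases "p < I j") auto
      moreover have "I j - 1 \<le> k" using I(2)[OF j] by linarith
      ultimately have 1: "i \<le> e (I j - 1)" "1 \<le> I j - 1" using sml[of p "I j - 1"] p by auto
      \<comment> \<open>Now \<open>i\<close> lies before and \<open>l\<close> after the clique of
        \<open>j\<close>, so \<open>j\<close> sees both neighbouring cliques, against the
        hypothesis.\<close>
      have "I j \<le> q" unfolding I_def by (rule Least_le) (use q in simp)
      then have 2: "e (I j) < l" "I j < k" using sml[of "I j" q] q by auto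
      have "R i \<le> R (e (I j - 1))" by (intro R_mono) (use 1 a x I(4)[OF j] in auto)
      moreover have "L (e (I j) + 1) \<le> j" using adj_iff[of j "e (I j) + 1"] a 2 x I(1)[OF j] by auto
      moreover have "R (e (I j - 1)) < L (e (I j) + 1)" using sep[of "I j - 1"] 1 2 by simp
      ultimately show False using a by linarith
    qed
  next
    assume "x \<noteq> 1"
    then have "R x \<le> e i" if "1 \<le> i" "i < k" for i
      using left sml[OF that(1)] that(2) by (meson le_trans less_imp_le)
    then show "e ` {1..<k} \<inter> {x..<R x} = {}" by fastforce
  next
    assume "y \<noteq> n"
    moreover have "e i \<le> e (k - 1)" if "i < k" for i by (rule sml) (use that in linarith)+
    ultimately have "e i < L y" if "i < k" for i using right that by (meson le_less_trans)
    then show "e ` {1..<k} \<inter> {L y..<y} = {}" by fastforce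
  qed
qed

text \<open>The ends of the greedy cliques serve as separators. An overlap at the right end of the
  graph needs no correction: the last clique merely loses its first vertex.\<close>

lemma separators_if_good:
  assumes b: "block x y" and g: "good x y"
  shows "\<exists>P. separators x y P"
proof -
  define k where "k = width x y"
  have x: "1 \<le> x" "x < y" "y \<le> n" using b unfolding block_def by auto
  have k: "1 \<le> k" using width_pos[of x y] x unfolding k_def by simp
  define t where "t i = clique_end x y i" for i
  have t: "t i = greedy x i" if "i < k" for i using that clique_end_simps t_def k_def by simp
  have tk: "t k = y" using clique_end_simps t_def k_def by simp
  have t0: "t 0 = x - 1" using t[of 0] k by simp
  have tle: "t i \<le> greedy x i" for i unfolding t_def clique_end_def by simp
  have ty: "t i < y" if "i < k" for i using t[OF that] that greedy_less_iff k_def by simp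
  have tmono: "t i < t (i + 1)" if "i < k" for i
    using that ty[OF that] t[OF that] t[of "i + 1"] tk greedy_less[of x i] by (cases "i + 1 = k") auto
  have tcl: "t (i + 1) \<le> R (t i + 1)" if "i < k" for i
    using tle[of "i + 1"] t[OF that] ty[OF that] x by simp
  have t1: "t 1 = min (R x) y" using greedy_1[OF b] unfolding t_def clique_end_def by simp
  show ?thesis
  proof (cases "k = 1")
    case True
    have "separators x y (t ` {1..<k})"
    proof (rule separators_sequence[OF b])
      show "x \<noteq> 1 \<Longrightarrow> R x \<le> t 1" using t1 tk True block_R[OF b, of x] x by simp
      show "y \<noteq> n \<Longrightarrow> t (k - 1) < L y" using True t0 block_L[OF b, of y] x by simp
    qed (use t0 tk tmono tcl True in auto)
    then show ?thesis by blast
  next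
    case False
    then have k2: "2 \<le> k" using k by simp
    define s where "s i = L (t i)" for i
    have cs: "clique_start x y i = s i" if "2 \<le> i" for i
      using clique_start_eq[OF b that] s_def t_def by simp
    have g1: "R (s i - 1) < L (t i + 1)" if "2 \<le> i" "i \<le> k - 1" for i
      using g False that cs[of i] unfolding good_def k_def t_def by auto
    have g2: "t i = s (i + 1) - 1 \<or> t i = s (i + 1) \<and> (i = 1 \<and> x = 1 \<or> i = k - 1 \<and> y = n)"
      if "1 \<le> i" "i \<le> k - 1" for i
      using g False that cs[of "i + 1"] unfolding good_def k_def t_def by auto
    have tx: "x < t i" if "2 \<le> i" for i
      using greedy_gt[OF that b] x unfolding t_def clique_end_def by simp
    have t1x: "t 1 = R x" "x < t 1" "t 1 < y" using t[of 1] k2 x R_gt[of x] ty[of 1] by auto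
    show ?thesis
    proof (cases "x = 1")
      case True
      \<comment> \<open>Moving the first separator to \<open>s 2 - 1\<close> gives a shared vertex
        to the second clique; without an overlap nothing changes. The requirement on the second
        clique speaks of exactly this position, and if there are only two cliques and
        \<open>y\<close> is a cut vertex, all edges at \<open>y\<close> stay inside the second
        one.\<close>
      define e where "e i = (if i = 1 then s 2 - 1 else t i)" for i
      have t2: "t 1 < t 2" "t 2 \<le> y" using tmono[of 1] k2 unfolding t_def clique_end_def by (auto simp: numeral_2_eq_2)
      have s2: "1 < s 2" "s 2 \<le> t 1 + 1" "t 1 \<le> s 2"
      proof -
        show "1 < s 2" using adj_iff[of 1 "t 2"] t2 x t1x True unfolding s_def by (simp add: not_le[symmetric])
        moreover have "1 \<le> k - 1" using k2 by linarith
        ultimately show "t 1 \<le> s 2" "s 2 \<le> t 1 + 1" using g2[of 1] by (auto simp: numeral_2_eq_2)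
      qed
      have "separators x y (e ` {1..<k})"
      proof (rule separators_sequence[OF b])
        show "e 0 = x - 1" "e k = y" using t0 tk k2 unfolding e_def by auto
        fix i
        show "e i < e (i + 1)" if "i < k"
          using tmono[OF that] s2 t2 t0 True that unfolding e_def by (auto simp: numeral_2_eq_2)
        show "e (i + 1) \<le> R (e i + 1)" if ik: "i < k"
        proof -
          consider "i = 0" | "i = 1" | "2 \<le> i" by linarith
          then show ?thesis
          proof cases
            case 1
            then show ?thesis using s2 t1x t0 True unfolding e_def by simp
          next
            case 2
            have "t 2 \<le> R (s 2)"
              using adj_iff[of "s 2" "t 2"] s2 t2 x L_le[of "t 2"] unfolding s_def by simp
            then show ?thesis using 2 s2 unfolding e_def by (simp add: numeral_2_eq_2)
          next
            case 3
            then show ?thesis using tcl[OF ik] unfolding e_def by simp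
          qed
        qed
        show "R (e i) < L (e (i + 1) + 1)" if "1 \<le> i" "i + 1 < k"
        proof (cases "i = 1")
          case True
          then show ?thesis using g1[of 2] that unfolding e_def by (simp add: numeral_2_eq_2)
        next
          case False
          moreover have "i \<le> k - 1" "i \<noteq> k - 1" using that by linarith+
          ultimately have "t i = s (i + 1) - 1" using g2[of i] that by auto
          then show ?thesis using g1[of "i + 1"] that False unfolding e_def by simp
        qed
        show "x \<noteq> 1 \<Longrightarrow> R x \<le> e 1" using True by simp
        show "e (k - 1) < L y" if "y \<noteq> n"
        proof (cases "k = 2")
          case True
          then show ?thesis using tk s2 unfolding e_def s_def by simp
        next
          case False
          moreover have k1: "1 \<le> k - 1" "k - 1 \<noteq> 1" "2 \<le> k - 1" using False k2 by linarith+
          ultimately have "t (k - 1) = s k - 1" using g2[of "k - 1"] k2 that by auto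
          moreover have "1 \<le> t (k - 1)" using tx[OF k1(3)] x by simp
          ultimately show ?thesis using False k2 tk unfolding e_def s_def by auto
        qed
      qed
      then show ?thesis by blast
    next
      case x1: False
      have "separators x y (t ` {1..<k})"
      proof (rule separators_sequence[OF b])
        show "x \<noteq> 1 \<Longrightarrow> R x \<le> t 1" using t1x by simp
        have t1': "1 \<le> t i" if "1 \<le> i" for i using tx[of i] t1x that by (cases "i = 1") auto
        show "R (t i) < L (t (i + 1) + 1)" if "1 \<le> i" "i + 1 < k" for i
        proof -
          have "i \<le> k - 1" "i \<noteq> k - 1" using that by linarith+
          then have "t i = s (i + 1) - 1" using g2[of i] that x1 by auto
          then show ?thesis using g1[of "i + 1"] that by simp
        qed
        show "t (k - 1) < L y" if "y \<noteq> n"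
        proof -
          have "1 \<le> k - 1" using k2 by linarith
          then have "t (k - 1) = s k - 1" using g2[of "k - 1"] k2 that x1 by auto
          then show ?thesis using t1'[OF \<open>1 \<le> k - 1\<close>] tk unfolding s_def by auto
        qed
      qed (use t0 tk tmono tcl in auto)
      then show ?thesis by blast
    qed
  qed
qed

end

section \<open>Gluing the blocks into one colouring\<close>

context connected_straight_order
begin

lemma block_exists:
  assumes "1 \<le> i" "i < n"
  shows "\<exists>x y. block x y \<and> x \<le> i \<and> i < y"
proof -
  define A where "A = {z. 1 \<le> z \<and> z \<le> i \<and> (z = 1 \<or> cut z)}"
  define B where "B = {z. i < z \<and> z \<le> n \<and> (z = n \<or> cut z)}"
  have A: "finite A" "1 \<in> A" using assms unfolding A_def by auto
  have B: "finite B" "n \<in> B" using assms unfolding B_def by auto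
  define x y where "x = Max A" and "y = Min B"
  have xA: "x \<in> A" using Max_in[of A] A unfolding x_def by blast
  have yB: "y \<in> B" using Min_in[of B] B unfolding y_def by blast
  have "\<not> cut z" if "x < z" "z < y" for z
  proof
    assume c: "cut z"
    show False
    proof (cases "z \<le> i")
      case True
      then have "z \<in> A" using c unfolding A_def cut_def by auto
      then show False using Max_ge[OF A(1)] that unfolding x_def by fastforce
    next
      case False
      then have "z \<in> B" using c unfolding B_def cut_def by auto
      then show False using Min_le[OF B(1)] that unfolding y_def by fastforce
    qed
  qed
  moreover have "1 \<le> x" "x \<le> i" "x = 1 \<or> cut x" "i < y" "y \<le> n" "y = n \<or> cut y"
    using xA yB unfolding A_def B_def by auto
  ultimately show ?thesis unfolding block_def by (intro exI[of _ x] exI[of _ y]) simp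
qed

text \<open>With \<open>block_exists\<close>, the half-open ranges from \<open>x\<close> to
  \<open>y\<close> partition the positions before \<open>n\<close>. A cut vertex is counted with the
  block on its right, so each edge is assigned to a block by its left end.\<close>

lemma block_unique:
  assumes "block x y" "block x' y'" "x \<le> i" "i < y" "x' \<le> i" "i < y'"
  shows "x = x' \<and> y = y'"
proof -
  have c: "x = 1 \<or> cut x" "x' = 1 \<or> cut x'" "y = n \<or> cut y" "y' = n \<or> cut y'"
    "\<And>z. x < z \<Longrightarrow> z < y \<Longrightarrow> \<not> cut z" "\<And>z. x' < z \<Longrightarrow> z < y' \<Longrightarrow> \<not> cut z"
    "1 \<le> x" "1 \<le> x'" "y \<le> n" "y' \<le> n"
    using assms(1,2) unfolding block_def by auto
  have "\<not> x < x'" using c(2,5,7) assms(4,5) by force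
  moreover have "\<not> x' < x" using c(1,6,8) assms(3,6) by force
  moreover have "\<not> y < y'" using c(3,6,10) assms(4,5) by force
  moreover have "\<not> y' < y" using c(4,5,9) assms(3,6) by force
  ultimately show ?thesis by simp
qed

lemma block_edge: assumes "block x y" "x \<le> i" "i < y" "j \<le> R i" shows "j \<le> y"
  using block_R[OF assms(1-3)] assms(4) by simp

text \<open>Colours flip at every cut vertex, and inside a block an edge is coloured according to
  whether some separator lies between its ends.\<close>

lemma alternating_if_good:
  assumes g: "\<And>x y. block x y \<Longrightarrow> good x y"
  shows "\<exists>c. alternating c"
proof -
  obtain Q where Q: "separators x y (Q x y)" if "block x y" for x y
    using separators_if_good g by metis
  define P where "P = {p. \<exists>x y. block x y \<and> p \<in> Q x y}"
  \<comment> \<open>The cut vertex itself is counted, so parity is constant on the left ends of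
    edges of one block and changes from one block to the next.\<close>
  define parity where "parity i \<longleftrightarrow> even (card {z. cut z \<and> z \<le> i})" for i
  define c where "c i j \<longleftrightarrow> (P \<inter> {i..<j} = {}) = parity i" for i j
  have P: "P \<inter> {i..<j} = Q x y \<inter> {i..<j}" if b: "block x y" "x \<le> i" "j \<le> y" for x y i j
  proof
    show "P \<inter> {i..<j} \<subseteq> Q x y \<inter> {i..<j}"
    proof
      fix p assume p: "p \<in> P \<inter> {i..<j}"
      then obtain x' y' where b': "block x' y'" "p \<in> Q x' y'" unfolding P_def by auto
      then have "x' \<le> p" "p < y'" using Q[OF b'(1)] unfolding separators_def by auto
      then have "x' = x \<and> y' = y" using block_unique[OF b'(1) b(1), of p] p b by auto
      then show "p \<in> Q x y \<inter> {i..<j}" using p b' by auto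
    qed
    show "Q x y \<inter> {i..<j} \<subseteq> P \<inter> {i..<j}" using b(1) unfolding P_def by auto
  qed
  have fin: "finite {z. cut z \<and> z \<le> i}" for i by (rule finite_subset[of _ "{..i}"]) auto
  have par_same: "parity i = parity j" if "i \<le> j" "\<And>z. i < z \<Longrightarrow> z \<le> j \<Longrightarrow> \<not> cut z" for i j
  proof -
    have "{z. cut z \<and> z \<le> i} = {z. cut z \<and> z \<le> j}" using that by (auto simp: not_le[symmetric])
    then show ?thesis unfolding parity_def by simp
  qed
  have par_flip: "parity i \<noteq> parity j"
    if "i < j" "cut j" "\<And>z. i < z \<Longrightarrow> z < j \<Longrightarrow> \<not> cut z" for i j
  proof -
    have "z \<le> j \<longleftrightarrow> z = j \<or> z \<le> i" if "cut z" for z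
      using \<open>i < j\<close> that \<open>\<And>z. i < z \<Longrightarrow> z < j \<Longrightarrow> \<not> cut z\<close>[of z] by linarith
    then have "{z. cut z \<and> z \<le> j} = insert j {z. cut z \<and> z \<le> i}" using \<open>cut j\<close> by auto
    then have "card {z. cut z \<and> z \<le> j} = Suc (card {z. cut z \<and> z \<le> i})" using fin that(1) by simp
    then show ?thesis unfolding parity_def by simp
  qed
  have "c i j \<noteq> c j k"
    if a: "1 \<le> i" "i < j" "j < k" "k \<le> n" "j \<le> R i" "k \<le> R j" "R i < k" for i j k
  proof -
    obtain x y where b: "block x y" "x \<le> i" "i < y" using block_exists[of i] a by auto
    have jy: "j \<le> y" using block_edge[OF b a(5)] .
    have nc: "\<not> cut z" if "i < z" "z < j" for z using b that jy unfolding block_def by auto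
    show ?thesis
    \<comment> \<open>At a cut vertex both edges lie inside cliques and only the parities differ.
      Elsewhere the parities agree, and exactly one of the two edges crosses a separator: both is
      excluded by \<open>separators\<close>, and if neither did, \<open>i\<close> and
      \<open>k\<close> would be adjacent.\<close>
    proof (cases "cut j")
      case True
      then have "j = y" using b jy a unfolding block_def by (cases "j = y") auto
      obtain x' y' where b': "block x' y'" "x' \<le> j" "j < y'" using block_exists[of j] a by auto
      then have "x' = j" using True a unfolding block_def cut_def by (cases "x' = j") auto
      have yn: "y \<noteq> n" "x' \<noteq> 1" using True \<open>j = y\<close> \<open>x' = j\<close> unfolding cut_def by auto
      have "L y \<le> i" using adj_iff[of i j] a \<open>j = y\<close> by simp
      then have "{i..<j} \<subseteq> {L y..<y}" using \<open>j = y\<close> by auto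
      moreover have "Q x y \<inter> {L y..<y} = {}" using Q[OF b(1)] yn(1) unfolding separators_def by simp
      ultimately have "P \<inter> {i..<j} = {}" using P[OF b(1,2) jy] by blast
      moreover have "P \<inter> {j..<k} = {}"
      proof -
        have "{j..<k} \<subseteq> {x'..<R x'}" using \<open>x' = j\<close> a(6) by auto
        moreover have "Q x' y' \<inter> {x'..<R x'} = {}"
          using Q[OF b'(1)] yn(2) unfolding separators_def by simp
        ultimately show ?thesis using P[OF b'(1,2) block_edge[OF b' a(6)]] by blast
      qed
      ultimately show ?thesis using par_flip[OF a(2) True nc] unfolding c_def by auto
    next
      case False
      have jy': "j < y" using jy False b a unfolding block_def by (cases "j = y") auto
      have ky: "k \<le> y" using block_edge[OF b(1) _ jy' a(6)] a b by simp
      have "parity i = parity j" using par_same[of i j] False nc a by (metis le_less)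
      moreover have "P \<inter> {i..<j} = {} \<or> P \<inter> {j..<k} = {}"
      proof -
        have "x \<le> j" using a b by simp
        moreover have "Q x y \<inter> {i..<j} = {} \<or> Q x y \<inter> {j..<k} = {}"
          using Q[OF b(1)] b(2) a ky unfolding separators_def by blast
        ultimately show ?thesis using P[OF b(1,2) jy] P[OF b(1) _ ky] by simp
      qed
      moreover have "\<not> (P \<inter> {i..<j} = {} \<and> P \<inter> {j..<k} = {})"
      proof
        assume "P \<inter> {i..<j} = {} \<and> P \<inter> {j..<k} = {}"
        moreover have "{i..<k} = {i..<j} \<union> {j..<k}" using a by auto
        ultimately have "P \<inter> {i..<k} = {}" by (simp add: Int_Un_distrib)
        then have "Q x y \<inter> {i..<k} = {}" using P[OF b(1,2) ky] by simp
        moreover have "i < k" using a by simp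
        ultimately have "k \<le> R i" using Q[OF b(1)] b(2) ky unfolding separators_def by blast
        then show False using a by simp
      qed
      ultimately show ?thesis unfolding c_def by auto
    qed
  qed
  then show ?thesis unfolding alternating_def by blast
qed

end

lemma (in reduced_straight_order) alternating_iff_good:
  "(\<exists>c. alternating c) \<longleftrightarrow> (\<forall>x y. block x y \<longrightarrow> good x y)"
  using good_if_alternating alternating_if_good by blast

section \<open>Graphs with a straight ordering\<close>

locale straight_graph =
  fixes G :: "'a graph" and n :: nat and v :: "nat \<Rightarrow> 'a"
  assumes simple: "simple_graph G"
    and ordering: "straight_ordering G n v"
    and pos: "1 \<le> n"
begin

abbreviation "R \<equiv> rightmost G n v"
abbreviation "L \<equiv> leftmost G n v"

lemma inj: "inj_on v {1..n}" and verts_eq: "verts G = v ` {1..n}"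
  using ordering unfolding straight_ordering_def bij_betw_def by auto

lemma v_eq_iff: "i \<in> {1..n} \<Longrightarrow> j \<in> {1..n} \<Longrightarrow> v i = v j \<longleftrightarrow> i = j"
  using inj by (auto dest: inj_onD)

lemma v_mem_iff: "i \<in> {1..n} \<Longrightarrow> S \<subseteq> {1..n} \<Longrightarrow> v i \<in> v ` S \<longleftrightarrow> i \<in> S"
  using inj by (rule inj_on_image_mem_iff)

lemma nbhd:
  assumes "i \<in> {1..n}"
  shows "1 \<le> L i" "L i \<le> i" "i \<le> R i" "R i \<le> n" "closed_nbhd G (v i) = v ` {L i..R i}"
proof -
  obtain a b where ab: "1 \<le> a" "a \<le> i" "i \<le> b" "b \<le> n" "closed_nbhd G (v i) = v ` {a..b}"
    using conjunct2[OF ordering[unfolded straight_ordering_def], rule_format, OF assms] by blast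
  have sub: "{a..b} \<subseteq> {1..n}" using ab by auto
  then have "v j \<in> v ` {a..b} \<longleftrightarrow> j \<in> {a..b}" if "j \<in> {1..n}" for j using v_mem_iff that by blast
  then have nb: "{j \<in> {1..n}. v j \<in> closed_nbhd G (v i)} = {a..b}" using sub unfolding ab(5) by blast
  have "L i = a" unfolding leftmost_def nb by (rule Min_eqI) (use ab(2,3) in auto)
  moreover have "R i = b" unfolding rightmost_def nb by (rule Max_eqI) (use ab(2,3) in auto)
  ultimately show "1 \<le> L i" "L i \<le> i" "i \<le> R i" "R i \<le> n" "closed_nbhd G (v i) = v ` {L i..R i}"
    using ab by simp_all
qed

lemma edge_iff:
  assumes "i \<in> {1..n}" "j \<in> {1..n}" "i \<noteq> j"
  shows "{v i, v j} \<in> edges G \<longleftrightarrow> L i \<le> j \<and> j \<le> R i"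
proof -
  have "v i \<noteq> v j" "v j \<in> verts G" using assms v_eq_iff verts_eq by auto
  then have "{v i, v j} \<in> edges G \<longleftrightarrow> v j \<in> closed_nbhd G (v i)" unfolding closed_nbhd_def by auto
  also have "\<dots> \<longleftrightarrow> j \<in> {L i..R i}"
  proof -
    have "{L i..R i} \<subseteq> {1..n}" using nbhd(1-4)[OF assms(1)] by auto
    then show ?thesis unfolding nbhd(5)[OF assms(1)] by (rule v_mem_iff[OF assms(2)])
  qed
  finally show ?thesis by simp
qed

sublocale straight_order n R L
proof
  fix i j assume ij: "1 \<le> i" "i \<le> j" "j \<le> n"
  show "L j \<le> i \<longleftrightarrow> j \<le> R i"
  proof (cases "i = j")
    case True
    then show ?thesis using nbhd(1-4)[of i] ij by auto
  next
    case False
    \<comment> \<open>Symmetry of adjacency is what ties \<open>L\<close> to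
      \<open>R\<close>.\<close>
    then have "L i \<le> j \<and> j \<le> R i \<longleftrightarrow> L j \<le> i \<and> i \<le> R j"
      using edge_iff[of i j] edge_iff[of j i] ij by (simp add: insert_commute)
    then show ?thesis using nbhd(1-4)[of i] nbhd(1-4)[of j] ij by auto
  qed
qed (use nbhd(1-4) pos in simp_all)

lemma edge_less_iff:
  assumes "1 \<le> i" "i < j" "j \<le> n"
  shows "{v i, v j} \<in> edges G \<longleftrightarrow> j \<le> R i"
  using edge_iff[of i j] nbhd(2)[of i] assms by simp

lemma clique_image_iff:
  assumes "S \<subseteq> {1..n}"
  shows "clique G (v ` S) \<longleftrightarrow> (\<forall>i\<in>S. \<forall>j\<in>S. i < j \<longrightarrow> j \<le> R i)"
proof
  assume c: "clique G (v ` S)"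
  show "\<forall>i\<in>S. \<forall>j\<in>S. i < j \<longrightarrow> j \<le> R i"
  proof (intro ballI impI)
    fix i j assume ij: "i \<in> S" "j \<in> S" "i < j"
    then have "i \<in> {1..n}" "j \<in> {1..n}" using assms by auto
    moreover from this have "v i \<noteq> v j" using v_eq_iff ij(3) by auto
    then have "{v i, v j} \<in> edges G" using c ij unfolding clique_def by auto
    ultimately show "j \<le> R i" using edge_less_iff ij(3) by auto
  qed
next
  assume a: "\<forall>i\<in>S. \<forall>j\<in>S. i < j \<longrightarrow> j \<le> R i"
  have "{v i, v j} \<in> edges G" if ij: "i \<in> S" "j \<in> S" "v i \<noteq> v j" for i j
  proof -
    have b: "1 \<le> i" "i \<le> n" "1 \<le> j" "j \<le> n" using ij assms by auto
    consider "i < j" | "j < i" using ij(3) by fastforce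
    then show ?thesis
      by cases (use b ij a edge_less_iff[of i j] edge_less_iff[of j i] in \<open>auto simp: insert_commute\<close>)
  qed
  moreover have "v ` S \<subseteq> verts G" using assms verts_eq by auto
  ultimately show "clique G (v ` S)" unfolding clique_def by blast
qed

text \<open>Two neighbours of a vertex on the same side of it are adjacent, so local completeness
  restricts only pairs on opposite sides. Colour 1 stands for \<open>True\<close>.\<close>

lemma colouring_iff_alternating: "(\<exists>col. locally_complete_colouring G col) \<longleftrightarrow> (\<exists>c. alternating c)"
proof
  assume "\<exists>col. locally_complete_colouring G col"
  then obtain col where col: "locally_complete_colouring G col" by blast
  define c where "c i j \<longleftrightarrow> col {v i, v j} = 1" for i j
  have "c i j \<noteq> c j k"
    if a: "1 \<le> i" "i < j" "j < k" "k \<le> n" "j \<le> R i" "k \<le> R j" "R i < k" for i j k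
  proof
    assume cc: "c i j = c j k"
    have e: "{v j, v i} \<in> edges G" "{v j, v k} \<in> edges G"
      using edge_less_iff[of i j] edge_less_iff[of j k] a by (auto simp: insert_commute)
    have "col {v j, v i} \<in> {1, 2}" "col {v j, v k} \<in> {1, 2}"
      using col e unfolding locally_complete_colouring_def by auto
    then have eq: "col {v j, v k} = col {v j, v i}" "col {v j, v i} \<in> {1, 2}"
      using cc unfolding c_def by (auto simp: insert_commute)
    have vs: "v i \<in> verts G" "v j \<in> verts G" "v k \<in> verts G" using a verts_eq by auto
    have "clique G {y \<in> verts G. {v j, y} \<in> edges G \<and> col {v j, y} = col {v j, v i}}"
      using col vs eq unfolding locally_complete_colouring_def by blast
    moreover have "v i \<noteq> v k" using v_eq_iff[of i k] a by auto
    ultimately have "{v i, v k} \<in> edges G" using e eq vs unfolding clique_def by blast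
    then show False using edge_less_iff[of i k] a by simp
  qed
  then show "\<exists>c. alternating c" unfolding alternating_def by blast
next
  assume "\<exists>c. alternating c"
  then obtain c where c: "alternating c" by blast
  define col :: "'a set \<Rightarrow> nat" where
    "col e = (if \<exists>i j. 1 \<le> i \<and> i < j \<and> j \<le> n \<and> e = {v i, v j} \<and> c i j then 1 else 2)" for e
  have col: "col {v i, v j} = (if c i j then 1 else 2)" if "1 \<le> i" "i < j" "j \<le> n" for i j
  proof -
    have "i' = i \<and> j' = j" if "1 \<le> i'" "i' < j'" "j' \<le> n" "{v i, v j} = {v i', v j'}" for i' j'
      using that \<open>1 \<le> i\<close> \<open>i < j\<close> \<open>j \<le> n\<close> v_eq_iff[of i i'] v_eq_iff[of i j'] v_eq_iff[of j i'] v_eq_iff[of j j']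
      by (auto simp: doubleton_eq_iff)
    then show ?thesis using that unfolding col_def by auto
  qed
  have "clique G {y \<in> verts G. {v j, y} \<in> edges G \<and> col {v j, y} = k}" if j: "j \<in> {1..n}" for j k
  proof -
    define S where "S = {i \<in> {1..n}. {v j, v i} \<in> edges G \<and> col {v j, v i} = k}"
    have "{y \<in> verts G. {v j, y} \<in> edges G \<and> col {v j, y} = k} = v ` S"
      unfolding S_def verts_eq by auto
    moreover have "clique G (v ` S)"
    proof (subst clique_image_iff)
      show "S \<subseteq> {1..n}" unfolding S_def by auto
      show "\<forall>h\<in>S. \<forall>l\<in>S. h < l \<longrightarrow> l \<le> R h"
      proof (intro ballI impI, rule ccontr)
        fix h l assume hl: "h \<in> S" "l \<in> S" "h < l" "\<not> l \<le> R h"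
        have b: "1 \<le> h" "h \<le> n" "1 \<le> l" "l \<le> n" "1 \<le> j" "j \<le> n"
          and e: "{v j, v h} \<in> edges G" "{v j, v l} \<in> edges G" "col {v j, v h} = col {v j, v l}"
          using hl(1,2) j unfolding S_def by simp_all
        have "\<forall>e\<in>edges G. card e = 2" using simple unfolding simple_graph_def by simp
        then have "{v j, v j} \<notin> edges G" by (auto dest: bspec)
        then have "h \<noteq> j" "l \<noteq> j" using e(1,2) by auto
        \<comment> \<open>Otherwise \<open>h\<close> and \<open>l\<close> both lie to the right of
          \<open>j\<close> and are adjacent.\<close>
        have "h < j"
        proof (rule ccontr)
          assume "\<not> h < j"
          then have "l \<le> R j" "j \<le> h" using edge_less_iff[of j l] e(2) b hl(3) by simp_all
          then show False using R_mono[of j h] b hl(4) by simp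
        qed
        then have eh: "j \<le> R h" using edge_less_iff[of h j] e(1) b by (simp add: insert_commute)
        then have "j < l" using hl(4) \<open>l \<noteq> j\<close> by simp
        then have el: "l \<le> R j" using e(2) edge_less_iff[of j l] b by simp
        have "c h j \<noteq> c j l"
          using c[unfolded alternating_def, rule_format, of h j l] b hl(4) eh el \<open>h < j\<close> \<open>j < l\<close> by simp
        moreover have "col {v h, v j} = col {v j, v l}" using e(3) by (simp add: insert_commute)
        ultimately show False using col[of h j] col[of j l] b \<open>h < j\<close> \<open>j < l\<close> by (auto split: if_splits)
      qed
    qed
    ultimately show ?thesis by simp
  qed
  then have "locally_complete_colouring G col"
    unfolding locally_complete_colouring_def using verts_eq by (auto simp: col_def)
  then show "\<exists>col. locally_complete_colouring G col" by blast
qed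

section \<open>Segments and their clique covering numbers\<close>

lemma verts_segment: assumes "1 \<le> x" "y \<le> n" shows "verts (segment G v x y) = v ` {x..y}"
  using assms verts_eq unfolding segment_def induced_def by auto

lemma simple_segment: "simple_graph (segment G v x y)"
  using simple unfolding simple_graph_def segment_def induced_def by auto

lemma clique_segment_iff:
  "clique (segment G v x y) K \<longleftrightarrow> clique G K \<and> K \<subseteq> v ` {x..y}"
  unfolding clique_def segment_def induced_def by auto

text \<open>The greedy cliques give the upper bound. Their first vertices are pairwise nonadjacent,
  so any covering has a separate clique for each of them.\<close>

lemma cc_segment:
  assumes "1 \<le> x" "x \<le> y" "y \<le> n"
  shows "cc (segment G v x y) = width x y"
  unfolding cc_def verts_segment[OF assms(1,3)]
proof (rule Least_equality)
  define K where "K i = v ` {greedy x i + 1..min (greedy x (i + 1)) y}" for i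
  define k where "k = width x y"
  have cl: "clique (segment G v x y) (K i)" if "i < k" for i
  proof -
    have g: "greedy x i < y" using le_greedy_iff[of y x i] that unfolding k_def by auto
    have g0: "x - 1 \<le> greedy x i" using greedy_strict_mono[of x] strict_mono_less_eq[of "greedy x" 0 i] by simp
    have gn: "greedy x i < n" using g assms by simp
    have h: "j \<le> R h" if h: "greedy x i + 1 \<le> h" "h < j" "j \<le> greedy x (i + 1)" "j \<le> y" for h j
    proof -
      have "R (greedy x i + 1) \<le> R h" by (rule R_mono) (use h assms in auto)
      then show ?thesis using h gn by simp
    qed
    have "clique G (K i)"
    proof -
      have "{greedy x i + 1..min (greedy x (i + 1)) y} \<subseteq> {1..n}" using assms by auto
      from clique_image_iff[OF this] show ?thesis using h unfolding K_def
        by (auto simp del: greedy.simps)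
    qed
    moreover have "K i \<subseteq> v ` {x..y}" unfolding K_def using g0 by auto
    ultimately show ?thesis by (simp add: clique_segment_iff)
  qed
  \<comment> \<open>\<open>cc\<close> counts a set of cliques, so the greedy cliques must be
    distinct to number exactly \<open>k\<close>.\<close>
  have disj: "K i \<noteq> K j" if "i < j" "j < k" for i j
  proof
    assume e: "K i = K j"
    have g: "greedy x j < y" using le_greedy_iff[of y x j] that unfolding k_def by auto
    have le: "greedy x (i + 1) \<le> greedy x j" using that greedy_strict_mono by (simp add: strict_mono_less_eq del: greedy.simps)
    have "greedy x j < greedy x (j + 1)" using greedy_less by (simp del: greedy.simps)
    then have "v (greedy x j + 1) \<in> K j" unfolding K_def using g by (intro imageI) auto
    then have "v (greedy x j + 1) \<in> K i" using e by simp
    moreover have "greedy x j + 1 \<in> {1..n}" "{greedy x i + 1..min (greedy x (i + 1)) y} \<subseteq> {1..n}"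
      using g assms by auto
    ultimately have "greedy x j + 1 \<in> {greedy x i + 1..min (greedy x (i + 1)) y}"
      unfolding K_def using v_mem_iff by blast
    then show False using le by simp
  qed
  have "inj_on K {..<k}" by (rule linorder_inj_onI) (use disj in auto)
  then have "card (K ` {..<k}) = k" by (simp add: card_image)
  moreover have "\<Union> (K ` {..<k}) = v ` {x..y}"
  proof
    show "\<Union> (K ` {..<k}) \<subseteq> v ` {x..y}" using cl clique_segment_iff by blast
    show "v ` {x..y} \<subseteq> \<Union> (K ` {..<k})"
    proof
      fix a assume "a \<in> v ` {x..y}"
      then obtain z where z: "x \<le> z" "z \<le> y" "a = v z" by auto
      define i where "i = width x z"
      have i: "1 \<le> i" using width_pos[of x z] assms z unfolding i_def by simp
      have "z \<le> greedy x i" "\<not> z \<le> greedy x (i - 1)"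
        using le_greedy_iff[of z x i] le_greedy_iff[of z x "i - 1"] i unfolding i_def by auto
      moreover have "i \<le> k" using le_greedy_iff[of z x k] le_greedy_width[of y x] z unfolding i_def k_def by simp
      ultimately have "a \<in> K (i - 1)" "i - 1 < k" using z i unfolding K_def by (auto intro!: imageI)
      then show "a \<in> \<Union> (K ` {..<k})" by auto
    qed
  qed
  ultimately show "\<exists>C. finite C \<and> card C = width x y \<and> (\<forall>K\<in>C. clique (segment G v x y) K) \<and> \<Union> C = v ` {x..y}"
    using cl by (intro exI[of _ "K ` {..<k}"]) (auto simp: k_def)
next
  fix k assume "\<exists>C. finite C \<and> card C = k \<and> (\<forall>K\<in>C. clique (segment G v x y) K) \<and> \<Union> C = v ` {x..y}"
  then obtain C where C: "finite C" "card C = k" "\<forall>K\<in>C. clique (segment G v x y) K" "\<Union> C = v ` {x..y}"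
    by (elim exE conjE)
  define w where "w = width x y"
  define p where "p i = greedy x i + 1" for i
  have p: "x \<le> p i" "p i \<le> y" if "i < w" for i
    using le_greedy_iff[of y x i] strict_mono_less_eq[OF greedy_strict_mono, of x 0 i] that
    unfolding p_def w_def by auto
  have "\<exists>K. K \<in> C \<and> v (p i) \<in> K" if "i < w" for i
  proof -
    have "v (p i) \<in> \<Union> C" unfolding C(4) using p[OF that] by simp
    then show ?thesis by blast
  qed
  then obtain f where f: "f i \<in> C" "v (p i) \<in> f i" if "i < w" for i by metis
  have "f i \<noteq> f j" if ij: "i < j" "j < w" for i j
  proof
    assume e: "f i = f j"
    have pij: "R (p i) < p j" "p i < p j"
    proof -
      have "greedy x (i + 1) \<le> greedy x j" using ij greedy_strict_mono by (simp add: strict_mono_less_eq del: greedy.simps)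
      moreover have "greedy x i < n" using p[of i] ij assms unfolding p_def by simp
      ultimately show 1: "R (p i) < p j" unfolding p_def by simp
      have "p i \<le> R (p i)" using R_ge[of "p i"] p[of i] ij assms by simp
      then show "p i < p j" using 1 by simp
    qed
    have b: "p i \<in> {1..n}" "p j \<in> {1..n}" using p[of i] p[of j] ij assms by auto
    have "clique G (f i)" using C(3) f(1)[of i] ij clique_segment_iff by simp
    moreover have "v (p i) \<noteq> v (p j)" using v_eq_iff b pij by auto
    moreover have "v (p i) \<in> f i" "v (p j) \<in> f i" using e f(2)[of i] f(2)[of j] ij by simp_all
    ultimately have "{v (p i), v (p j)} \<in> edges G" unfolding clique_def by blast
    then show False using edge_less_iff[of "p i" "p j"] b pij by auto
  qed
  then have "inj_on f {..<w}" by (intro linorder_inj_onI) auto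
  then have "w \<le> card C" using card_inj_on_le[of f "{..<w}" C] f C(1) by auto
  then show "width x y \<le> k" using C(2) w_def by simp
qed

lemma segment_nbhd:
  assumes "1 \<le> x" "y \<le> n" "x \<le> i" "i \<le> y"
  shows "closed_nbhd (segment G v x y) (v i) = v ` {max (L i) x..min (R i) y}"
proof -
  have "closed_nbhd (segment G v x y) (v i) = closed_nbhd G (v i) \<inter> v ` {x..y}"
    using assms verts_segment[OF assms(1,2)] verts_eq unfolding closed_nbhd_def segment_def induced_def by auto
  also have "\<dots> = v ` ({L i..R i} \<inter> {x..y})"
  proof -
    have i: "i \<in> {1..n}" using assms by simp
    have "{L i..R i} \<subseteq> {1..n}" "{x..y} \<subseteq> {1..n}" using nbhd(1-4)[OF i] assms by auto
    then show ?thesis unfolding nbhd(5)[OF i] by (rule inj_on_image_Int[OF inj, symmetric])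
  qed
  also have "{L i..R i} \<inter> {x..y} = {max (L i) x..min (R i) y}" by auto
  finally show ?thesis .
qed

lemma straight_segment:
  assumes "1 \<le> x" "x \<le> y" "y \<le> n"
  shows "straight_ordering (segment G v x y) (y + 1 - x) (\<lambda>k. v (x + k - 1))"
proof -
  have im: "(\<lambda>k. v (x + k - 1)) ` {a + 1 - x..b + 1 - x} = v ` {a..b}" if "x \<le> a" for a b
  proof -
    have "v ` {a..b} = (\<lambda>k. v (x + k - 1)) ` (\<lambda>i. i + 1 - x) ` {a..b}"
      unfolding image_image by (rule image_cong) (use that in auto)
    also have "(\<lambda>i. i + 1 - x) ` {a..b} = {a + 1 - x..b + 1 - x}"
    proof
      show "{a + 1 - x..b + 1 - x} \<subseteq> (\<lambda>i. i + 1 - x) ` {a..b}"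
        using that assms(1) by (auto intro!: image_eqI[of _ _ "_ + x - 1"])
    qed (use that in auto)
    finally show ?thesis by simp
  qed
  have "inj_on (\<lambda>k. v (x + k - 1)) {1..y + 1 - x}"
  proof (rule inj_onI)
    fix k l assume kl: "k \<in> {1..y + 1 - x}" "l \<in> {1..y + 1 - x}" "v (x + k - 1) = v (x + l - 1)"
    then have "x + k - 1 \<in> {1..n}" "x + l - 1 \<in> {1..n}" using assms by auto
    then have "x + k - 1 = x + l - 1" using v_eq_iff kl(3) by blast
    then show "k = l" using kl by auto
  qed
  then have "bij_betw (\<lambda>k. v (x + k - 1)) {1..y + 1 - x} (verts (segment G v x y))"
    using im[of x y] verts_segment[OF assms(1,3)] unfolding bij_betw_def by auto
  moreover have "\<exists>a b. 1 \<le> a \<and> a \<le> k \<and> k \<le> b \<and> b \<le> y + 1 - x \<and>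
      closed_nbhd (segment G v x y) (v (x + k - 1)) = (\<lambda>k. v (x + k - 1)) ` {a..b}"
    if k: "k \<in> {1..y + 1 - x}" for k
  proof -
    define i where "i = x + k - 1"
    have i: "x \<le> i" "i \<le> y" "k = i + 1 - x" using k assms unfolding i_def by auto
    have "closed_nbhd (segment G v x y) (v i) = (\<lambda>k. v (x + k - 1)) ` {max (L i) x + 1 - x..min (R i) y + 1 - x}"
      using segment_nbhd[OF assms(1,3) i(1,2)] im[of "max (L i) x" "min (R i) y"] by simp
    moreover have "1 \<le> max (L i) x + 1 - x" "max (L i) x + 1 - x \<le> k" "k \<le> min (R i) y + 1 - x"
      "min (R i) y + 1 - x \<le> y + 1 - x"
      using i nbhd(1-4)[of i] assms by auto
    ultimately show ?thesis unfolding i_def[symmetric] by blast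
  qed
  ultimately show ?thesis unfolding straight_ordering_def by blast
qed

lemma straight_graph_segment:
  assumes "1 \<le> x" "x \<le> y" "y \<le> n"
  shows "straight_graph (segment G v x y) (y + 1 - x) (\<lambda>k. v (x + k - 1))"
  using straight_segment[OF assms] simple_segment assms by unfold_locales auto

text \<open>Restriction truncates the neighbourhoods at \<open>x\<close> and \<open>y\<close>;
  adding 1 and subtracting \<open>x\<close> is the re-indexing.\<close>

lemma segment_bounds:
  assumes "1 \<le> x" "y \<le> n" "x \<le> i" "i \<le> y"
  shows "rightmost (segment G v x y) (y + 1 - x) (\<lambda>k. v (x + k - 1)) (i + 1 - x) = min (R i) y + 1 - x"
    and "leftmost (segment G v x y) (y + 1 - x) (\<lambda>k. v (x + k - 1)) (i + 1 - x) = max (L i) x + 1 - x"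
proof -
  have vi: "v (x + (i + 1 - x) - 1) = v i" using assms by simp
  define a b where "a = max (L i) x" and "b = min (R i) y"
  have ab: "x \<le> a" "a \<le> i" "i \<le> b" "b \<le> y" using nbhd(1-4)[of i] assms unfolding a_def b_def by auto
  have "{j \<in> {1..y + 1 - x}. v (x + j - 1) \<in> closed_nbhd (segment G v x y) (v i)} = {a + 1 - x..b + 1 - x}"
  proof -
    have "v (x + j - 1) \<in> v ` {a..b} \<longleftrightarrow> j \<in> {a + 1 - x..b + 1 - x}" if "j \<in> {1..y + 1 - x}" for j
    proof -
      have "x + j - 1 \<in> {1..n}" "{a..b} \<subseteq> {1..n}" using that ab assms by auto
      then have "v (x + j - 1) \<in> v ` {a..b} \<longleftrightarrow> x + j - 1 \<in> {a..b}" by (rule v_mem_iff)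
      also have "\<dots> \<longleftrightarrow> j \<in> {a + 1 - x..b + 1 - x}" using ab assms that by auto
      finally show ?thesis .
    qed
    moreover have "{a + 1 - x..b + 1 - x} \<subseteq> {1..y + 1 - x}" using ab assms by auto
    ultimately show ?thesis unfolding segment_nbhd[OF assms] a_def[symmetric] b_def[symmetric]
      by blast
  qed
  moreover have "Max {a + 1 - x..b + 1 - x} = b + 1 - x" "Min {a + 1 - x..b + 1 - x} = a + 1 - x"
    using ab by (auto intro!: Max_eqI Min_eqI)
  ultimately show "rightmost (segment G v x y) (y + 1 - x) (\<lambda>k. v (x + k - 1)) (i + 1 - x) = min (R i) y + 1 - x"
    "leftmost (segment G v x y) (y + 1 - x) (\<lambda>k. v (x + k - 1)) (i + 1 - x) = max (L i) x + 1 - x"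
    unfolding rightmost_def leftmost_def vi a_def b_def by auto
qed

end

section \<open>Components and cutvertices\<close>

definition adjacency :: "'a graph \<Rightarrow> ('a \<times> 'a) set" where
  "adjacency G = {(a, b). {a, b} \<in> edges G}"

lemma connection_eq: "connection G = {(x, y). x \<in> verts G \<and> y \<in> verts G \<and> (x, y) \<in> (adjacency G)\<^sup>*}"
  unfolding connection_def adjacency_def by simp

lemma sym_adjacency: "sym (adjacency G)"
  unfolding adjacency_def by (rule symI) (auto simp: insert_commute)

lemma equiv_connection: "equiv (verts G) (connection G)"
proof (rule equivI)
  show "connection G \<subseteq> verts G \<times> verts G" unfolding connection_eq by auto
  show "refl_on (verts G) (connection G)" unfolding connection_eq by (auto intro: refl_onI)
  show "sym (connection G)" unfolding connection_eq
    using sym_rtrancl[OF sym_adjacency[of G]] by (auto intro!: symI dest: symD)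
  show "trans (connection G)" unfolding connection_eq by (auto intro!: transI)
qed

text \<open>Only an inequality, since the empty graph has no component; it arises on removing the
  only vertex of a graph.\<close>

lemma card_components_connected:
  assumes "connection G = verts G \<times> verts G" shows "card (components G) \<le> 1"
proof -
  have "components G \<subseteq> {verts G}" unfolding components_def assms by (auto elim!: quotientE)
  then have "card (components G) \<le> card {verts G}" by (intro card_mono) auto
  then show ?thesis by simp
qed

lemma card_components_pos:
  assumes "finite (verts G)" "verts G \<noteq> {}" shows "1 \<le> card (components G)"
proof -
  have "finite (components G)" unfolding components_def
    using finite_quotient[OF assms(1)] equiv_type[OF equiv_connection] by auto
  moreover have "components G \<noteq> {}" unfolding components_def using assms(2) by (simp add: quotient_is_empty)
  ultimately show ?thesis by (simp add: card_gt_0_iff Suc_leI)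
qed

lemma card_components_disconnected:
  assumes "finite (verts G)" "a \<in> verts G" "b \<in> verts G" "(a, b) \<notin> connection G"
  shows "2 \<le> card (components G)"
proof -
  have fin: "finite (components G)" unfolding components_def
    using finite_quotient[OF assms(1)] equiv_type[OF equiv_connection] by auto
  have "connection G `` {a} \<noteq> connection G `` {b}"
    using eq_equiv_class[OF _ equiv_connection] assms by metis
  then have "card {connection G `` {a}, connection G `` {b}} = 2" by simp
  moreover have "{connection G `` {a}, connection G `` {b}} \<subseteq> components G"
    unfolding components_def using assms by (auto intro: quotientI)
  ultimately show ?thesis using card_mono[OF fin] by metis
qed

context straight_graph
begin

text \<open>Going repeatedly to an earlier neighbour leads from every vertex to the least element of
  \<open>S\<close>.\<close>

lemma connection_induced:
  assumes S: "S \<subseteq> {1..n}"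
    and pred: "\<And>i. i \<in> S \<Longrightarrow> (\<forall>j\<in>S. i \<le> j) \<or> (\<exists>j\<in>S. j < i \<and> i \<le> R j)"
  shows "connection (induced G (v ` S)) = verts (induced G (v ` S)) \<times> verts (induced G (v ` S))"
proof (cases "S = {}")
  case True
  then show ?thesis unfolding connection_def induced_def by auto
next
  case False
  let ?H = "induced G (v ` S)"
  have vH: "verts ?H = v ` S" using S verts_eq unfolding induced_def by auto
  define m where "m = (LEAST i. i \<in> S)"
  have m: "m \<in> S" "\<And>i. i \<in> S \<Longrightarrow> m \<le> i" using False LeastI_ex[of "\<lambda>i. i \<in> S"] Least_le[of "\<lambda>i. i \<in> S"]
    unfolding m_def by auto
  have reach: "(v m, v i) \<in> (adjacency ?H)\<^sup>*" if "i \<in> S" for i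
    using that
  proof (induction i rule: less_induct)
    case (less i)
    show ?case
    proof (cases "i = m")
      case False
      then have "\<not> (\<forall>j\<in>S. i \<le> j)" using m less(2) le_antisym by blast
      then obtain j where j: "j \<in> S" "j < i" "i \<le> R j" using pred[OF less(2)] by blast
      have "1 \<le> j" "i \<le> n" using j less(2) S by auto
      then have "{v j, v i} \<in> edges ?H" using edge_less_iff[of j i] j less(2) unfolding induced_def by auto
      then show ?thesis using less(1)[OF j(2,1)] unfolding adjacency_def
        by (auto intro: rtrancl.rtrancl_into_rtrancl)
    qed simp
  qed
  have "(a, b) \<in> (adjacency ?H)\<^sup>*" if ab: "a \<in> v ` S" "b \<in> v ` S" for a b
  proof -
    have "(v m, a) \<in> (adjacency ?H)\<^sup>*" "(v m, b) \<in> (adjacency ?H)\<^sup>*" using reach ab by auto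
    moreover from this(1) have "(a, v m) \<in> (adjacency ?H)\<^sup>*"
      using sym_rtrancl[OF sym_adjacency[of ?H]] by (auto dest: symD)
    ultimately show ?thesis by (meson rtrancl_trans)
  qed
  then show ?thesis unfolding connection_eq vH by auto
qed

text \<open>A walk from \<open>a\<close> inside \<open>S\<close> never leaves the positions up to
  \<open>p\<close>.\<close>

lemma not_connection_induced:
  assumes S: "S \<subseteq> {1..n}"
    and gap: "\<And>i j. i \<in> S \<Longrightarrow> j \<in> S \<Longrightarrow> i \<le> p \<Longrightarrow> p < j \<Longrightarrow> R i < j"
    and ab: "a \<in> S" "b \<in> S" "a \<le> p" "p < b"
  shows "(v a, v b) \<notin> connection (induced G (v ` S))"
proof
  let ?H = "induced G (v ` S)"
  assume "(v a, v b) \<in> connection ?H"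
  then have r: "(v a, v b) \<in> (adjacency ?H)\<^sup>*" unfolding connection_eq by auto
  have "c \<in> v ` {i \<in> S. i \<le> p}" if "(v a, c) \<in> (adjacency ?H)\<^sup>*" for c
    using that
  proof (induction rule: rtrancl_induct)
    case base
    then show ?case using ab by auto
  next
    case (step c d)
    then obtain i where i: "i \<in> S" "i \<le> p" "c = v i" by auto
    have e: "{c, d} \<in> edges G" "{c, d} \<subseteq> v ` S" using step(2) unfolding adjacency_def induced_def by auto
    then obtain j where j: "j \<in> S" "d = v j" by auto
    show ?case
    proof (cases "j \<le> p")
      case False
      have "1 \<le> i" "j \<le> n" using i j S by auto
      then have "j \<le> R i" using edge_less_iff[of i j] e i j False by simp
      then show ?thesis using gap[of i j] i j False by simp
    qed (use j in auto)
  qed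
  then obtain i where i: "i \<in> S" "i \<le> p" "v b = v i" using r by blast
  then have "b \<in> {1..n}" "i \<in> {1..n}" using ab S by blast+
  then have "b = i" using v_eq_iff i(3) by blast
  then show False using i ab by simp
qed

lemma induced_all: "induced G (v ` {1..n}) = G"
proof -
  have "{e \<in> edges G. e \<subseteq> verts G} = edges G" using simple unfolding simple_graph_def by auto
  then show ?thesis unfolding induced_def verts_eq[symmetric] by simp
qed

lemma connected_iff: "connected_graph G \<longleftrightarrow> (\<forall>i. 1 \<le> i \<and> i < n \<longrightarrow> i < R i)"
proof
  assume c: "connected_graph G"
  show "\<forall>i. 1 \<le> i \<and> i < n \<longrightarrow> i < R i"
  proof (intro allI impI, rule ccontr)
    fix i assume i: "1 \<le> i \<and> i < n" "\<not> i < R i"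
    have "(v 1, v n) \<notin> connection (induced G (v ` {1..n}))"
    proof (rule not_connection_induced[where p = i])
      fix h j assume "h \<in> {1..n}" "j \<in> {1..n}" "h \<le> i" "i < j"
      then show "R h < j" using R_mono[of h i] i by auto
    qed (use i in auto)
    moreover have "v 1 \<in> verts G" "v n \<in> verts G" using verts_eq pos by auto
    ultimately show False using c unfolding induced_all connected_graph_def by auto
  qed
next
  assume r: "\<forall>i. 1 \<le> i \<and> i < n \<longrightarrow> i < R i"
  have "connection (induced G (v ` {1..n})) = verts (induced G (v ` {1..n})) \<times> verts (induced G (v ` {1..n}))"
  proof (rule connection_induced)
    fix i assume i: "i \<in> {1..n}"
    show "(\<forall>j\<in>{1..n}. i \<le> j) \<or> (\<exists>j\<in>{1..n}. j < i \<and> i \<le> R j)"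
    proof (cases "i = 1")
      case False
      then have "1 \<le> i - 1" "i - 1 < n" "i - 1 < i" using i by auto
      then have "i \<le> R (i - 1)" using r by fastforce
      then show ?thesis using \<open>1 \<le> i - 1\<close> \<open>i - 1 < n\<close> \<open>i - 1 < i\<close> by (intro disjI2 bexI[of _ "i - 1"]) auto
    qed auto
  qed simp
  then show "connected_graph G" using verts_eq pos unfolding induced_all connected_graph_def by auto
qed

lemma finite_verts: "finite (verts G)"
  using simple unfolding simple_graph_def by simp

text \<open>If \<open>x\<close> is not a cut, every remaining vertex but the first keeps an earlier
  neighbour: its predecessor, or \<open>x - 1\<close> in the case of \<open>x + 1\<close>. If it is,
  \<open>x - 1\<close> and \<open>x + 1\<close> fall apart.\<close>

lemma cutvertex_iff:
  assumes c: "connected_graph G" and x: "x \<in> {1..n}"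
  shows "cutvertex G (v x) \<longleftrightarrow> cut x"
proof -
  have gt: "\<And>i. 1 \<le> i \<Longrightarrow> i < n \<Longrightarrow> i < R i" using c connected_iff by blast
  define S where "S = {1..n} - {x}"
  have S: "S \<subseteq> {1..n}" unfolding S_def by auto
  have VS: "verts G - {v x} = v ` S" using inj x unfolding S_def verts_eq by (auto dest: inj_onD)
  let ?H = "induced G (v ` S)"
  have vH: "verts ?H = v ` S" using S verts_eq unfolding induced_def by auto
  have "card (components G) \<le> 1" "1 \<le> card (components G)"
    using card_components_connected[of G] card_components_pos[OF finite_verts] c
    unfolding connected_graph_def by simp_all
  then have iff: "cutvertex G (v x) \<longleftrightarrow> 1 < card (components ?H)"
    using x verts_eq unfolding cutvertex_def VS by auto
  show ?thesis
  proof (cases "cut x")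
    case True
    have xx: "1 < x" "x < n" "R (x - 1) = x" using True unfolding cut_def by auto
    have "(v (x - 1), v (x + 1)) \<notin> connection ?H"
    proof (rule not_connection_induced[OF S, where p = "x - 1"])
      fix i j assume ij: "i \<in> S" "j \<in> S" "i \<le> x - 1" "x - 1 < j"
      have "R i \<le> R (x - 1)" by (rule R_mono) (use ij xx S in auto)
      moreover have "x \<noteq> j" using ij(2) unfolding S_def by auto
      ultimately show "R i < j" using xx ij by linarith
    qed (use xx in \<open>auto simp: S_def\<close>)
    moreover have "x - 1 \<in> S" "x + 1 \<in> S" using xx(1,2) unfolding S_def by auto
    then have "v (x - 1) \<in> verts ?H" "v (x + 1) \<in> verts ?H" unfolding vH by simp_all
    moreover have "finite (verts ?H)" using vH S by (simp add: finite_subset)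
    ultimately show ?thesis using card_components_disconnected[of ?H] iff True by force
  next
    case False
    have "connection ?H = verts ?H \<times> verts ?H"
    proof (rule connection_induced[OF S])
      fix i assume i: "i \<in> S"
      then have i1: "1 \<le> i" "i \<le> n" "i \<noteq> x" unfolding S_def by auto
      consider "i = 1" | "i = 2" "x = 1" | "1 < i" "i - 1 \<noteq> x" | "2 < i" "i - 1 = x" using i1 by linarith
      then show "(\<forall>j\<in>S. i \<le> j) \<or> (\<exists>j\<in>S. j < i \<and> i \<le> R j)"
      proof cases
        case 1
        then show ?thesis using S by auto
      next
        case 2
        then show ?thesis unfolding S_def by auto
      next
        case 3
        then have "i - 1 < R (i - 1)" using i1 by (intro gt) auto
        then show ?thesis using 3 i1 unfolding S_def by (intro disjI2 bexI[of _ "i - 1"]) auto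
      next
        case 4
        have "1 \<le> x - 1" "x - 1 < n" "1 < x" "x < n" using 4 i1 by auto
        then have "x - 1 < R (x - 1)" "R (x - 1) \<noteq> x" using gt False unfolding cut_def by auto
        then show ?thesis using 4 i1 unfolding S_def by (intro disjI2 bexI[of _ "x - 1"]) auto
      qed
    qed
    then show ?thesis using card_components_connected[of ?H] iff False by simp
  qed
qed

lemma proper_interval_segment:
  assumes "proper_interval_graph G"
  shows "proper_interval_graph (segment G v x y)"
proof -
  obtain I :: "'a \<Rightarrow> real set" where I: "\<forall>x\<in>verts G. is_interval (I x) \<and> I x \<noteq> {}"
    "\<forall>x\<in>verts G. \<forall>y\<in>verts G. x \<noteq> y \<longrightarrow> ({x, y} \<in> edges G \<longleftrightarrow> I x \<inter> I y \<noteq> {})"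
    "\<forall>x\<in>verts G. \<forall>y\<in>verts G. \<not> I x \<subset> I y"
    using assms unfolding proper_interval_graph_def by blast
  show ?thesis unfolding proper_interval_graph_def
    by (intro conjI[OF simple_segment] exI[of _ I]) (use I in \<open>auto simp: segment_def induced_def\<close>)
qed

end

locale connected_straight_graph = straight_graph +
  assumes connected: "connected_graph G"
begin

sublocale connected_straight_order n R L
  by unfold_locales (use connected connected_iff in blast)

end

lemma (in connected_straight_graph) reduced_straight_order:
  assumes "reduced_graph G"
  shows "reduced_straight_order n R L"
proof unfold_locales
  fix i j assume a: "1 \<le> i" "i \<le> n" "1 \<le> j" "j \<le> n" "L i = L j" "R i = R j"
  then have "closed_nbhd G (v i) = closed_nbhd G (v j)" using nbhd(5)[of i] nbhd(5)[of j] by auto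
  moreover have "v i \<in> verts G" "v j \<in> verts G" using a verts_eq by auto
  ultimately have "v i = v j" using assms unfolding reduced_graph_def by blast
  then show "i = j" using v_eq_iff[of i j] a by simp
qed

section \<open>Canonical coverings and types of the blocks\<close>

context connected_straight_graph
begin

lemma segment_segment:
  assumes "1 \<le> x" "x + t \<le> y + 1"
  shows "segment (segment G v x y) (\<lambda>k. v (x + k - 1)) 1 t = segment G v x (x + t - 1)"
proof -
  have "(\<lambda>k. v (x + k - 1)) ` {1..t} = v ` (\<lambda>k. x + k - 1) ` {1..t}" by (simp add: image_image)
  also have "(\<lambda>k. x + k - 1) ` {1..t} = {x..x + t - 1}"
  proof
    show "{x..x + t - 1} \<subseteq> (\<lambda>k. x + k - 1) ` {1..t}"
    proof
      fix i assume "i \<in> {x..x + t - 1}"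
      then have "i = x + (i + 1 - x) - 1" "i + 1 - x \<in> {1..t}" using assms(1) by auto
      then show "i \<in> (\<lambda>k. x + k - 1) ` {1..t}" by blast
    qed
  qed (use assms(1) in auto)
  finally have im: "(\<lambda>k. v (x + k - 1)) ` {1..t} = v ` {x..x + t - 1}" .
  have "v ` {x..x + t - 1} \<subseteq> v ` {x..y}" by (rule image_mono) (use assms in auto)
  then show ?thesis unfolding segment_def im induced_def by auto
qed

lemma clique_end_bounds:
  assumes "block x y" "1 \<le> i" shows "x \<le> clique_end x y i" "clique_end x y i \<le> y"
proof -
  have "greedy x 0 < greedy x i" by (rule strict_monoD[OF greedy_strict_mono]) (use assms(2) in simp)
  then show "x \<le> clique_end x y i" "clique_end x y i \<le> y"
    using assms(1) unfolding clique_end_def block_def by auto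
qed

text \<open>The positions \<open>z\<close> with covering number \<open>i\<close> are those after
  \<open>greedy x (i - 1)\<close> and up to \<open>greedy x i\<close>; the largest one inside the
  block is the capped value.\<close>

lemma cov_t_segment:
  assumes b: "block x y" and i: "1 \<le> i" "i \<le> width x y"
  shows "cov_t (segment G v x y) (y + 1 - x) (\<lambda>k. v (x + k - 1)) i = clique_end x y i + 1 - x"
proof -
  have x: "1 \<le> x" "x < y" "y \<le> n" using b unfolding block_def by auto
  have cc: "cc (segment (segment G v x y) (\<lambda>k. v (x + k - 1)) 1 t) = width x (x + t - 1)"
    if "t \<in> {1..y + 1 - x}" for t
    using segment_segment[of x t y] cc_segment[of x "x + t - 1"] that x by auto
  define z where "z = clique_end x y i"
  have z: "x \<le> z" "z \<le> y" "z \<le> greedy x i"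
    using clique_end_bounds[OF b i(1)] unfolding z_def clique_end_def by auto
  have "width x z \<le> i" using le_greedy_iff z(3) by blast
  moreover have "\<not> width x z \<le> i - 1"
  proof
    assume "width x z \<le> i - 1"
    then have "z \<le> greedy x (i - 1)" using le_greedy_iff by blast
    moreover have "i - 1 < width x y" using i by linarith
    then have "greedy x (i - 1) < y" using greedy_less_iff by blast
    moreover have "greedy x (i - 1) < greedy x i"
      by (rule strict_monoD[OF greedy_strict_mono]) (use i in simp)
    ultimately show False unfolding z_def clique_end_def by auto
  qed
  ultimately have wz: "width x z = i" by linarith
  show ?thesis unfolding cov_t_def
  proof (rule Max_eqI)
    show "finite {t \<in> {1..y + 1 - x}. cc (segment (segment G v x y) (\<lambda>k. v (x + k - 1)) 1 t) = i}" by simp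
    fix t assume t: "t \<in> {t \<in> {1..y + 1 - x}. cc (segment (segment G v x y) (\<lambda>k. v (x + k - 1)) 1 t) = i}"
    then have "width x (x + t - 1) = i" using cc[of t] by simp
    then have "x + t - 1 \<le> greedy x i" using le_greedy_width by blast
    then show "t \<le> clique_end x y i + 1 - x" using t x unfolding clique_end_def by auto
  next
    have "z + 1 - x \<in> {1..y + 1 - x}" "x + (z + 1 - x) - 1 = z" using z x by auto
    then show "clique_end x y i + 1 - x \<in> {t \<in> {1..y + 1 - x}. cc (segment (segment G v x y) (\<lambda>k. v (x + k - 1)) 1 t) = i}"
      using cc[of "z + 1 - x"] wz unfolding z_def[symmetric] by simp
  qed
qed

lemma cov_s_segment:
  assumes b: "block x y" and i: "1 \<le> i" "i \<le> width x y"
  shows "cov_s (segment G v x y) (y + 1 - x) (\<lambda>k. v (x + k - 1)) i = clique_start x y i + 1 - x"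
proof -
  have x: "1 \<le> x" "y \<le> n" using b unfolding block_def by auto
  show ?thesis unfolding cov_s_def cov_t_segment[OF assms] clique_start_def
    using segment_bounds(2)[OF x clique_end_bounds[OF b i(1)]] .
qed

text \<open>A cutvertex of the segment lies strictly inside it, where the truncation at
  \<open>y\<close> does not change the condition on \<open>R\<close>; it would thus be a cut of the
  whole graph inside a block.\<close>

lemma two_connected_segment:
  assumes b: "block x y" and xy: "x + 2 \<le> y"
  shows "two_connected (segment G v x y)"
proof -
  have x: "1 \<le> x" "x \<le> y" "y \<le> n" using b unfolding block_def by auto
  interpret B: straight_graph "segment G v x y" "y + 1 - x" "\<lambda>k. v (x + k - 1)"
    using straight_graph_segment[OF x] .
  have RB: "B.R (i + 1 - x) = min (R i) y + 1 - x" if "x \<le> i" "i \<le> y" for i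
    using segment_bounds(1)[OF x(1,3) that] .
  have con: "connected_graph (segment G v x y)"
    unfolding B.connected_iff
  proof (intro allI impI)
    fix k assume k: "1 \<le> k \<and> k < y + 1 - x"
    define i where "i = x + k - 1"
    have i: "x \<le> i" "i < y" "k = i + 1 - x" using k x unfolding i_def by auto
    have "i < R i" using R_gt[of i] i x by simp
    then show "k < B.R k" unfolding i(3) RB[OF i(1) less_imp_le[OF i(2)]] using i by auto
  qed
  have "\<not> cutvertex (segment G v x y) a" if a: "a \<in> verts (segment G v x y)" for a
  proof -
    obtain k where k: "k \<in> {1..y + 1 - x}" "a = v (x + k - 1)" using a B.verts_eq by blast
    define i where "i = x + k - 1"
    have i: "x \<le> i" "i \<le> y" "k = i + 1 - x" using k(1) x unfolding i_def by auto
    have "\<not> B.cut k"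
    proof
      assume "B.cut k"
      then have c: "1 < k" "k < y + 1 - x" "B.R (k - 1) = k" unfolding B.cut_def by auto
      have i': "x < i" "i < y" "k - 1 = (i - 1) + 1 - x" using c(1,2) i by auto
      have "B.R ((i - 1) + 1 - x) = min (R (i - 1)) y + 1 - x" by (rule RB) (use i' in auto)
      then have "min (R (i - 1)) y + 1 - x = i + 1 - x" using c(3) i(3) i'(3) by simp
      then have "R (i - 1) = i" using i' by (auto simp: min_def split: if_splits)
      then have "cut i" using i' x unfolding cut_def by auto
      then show False using b i' unfolding block_def by blast
    qed
    then show ?thesis using B.cutvertex_iff[OF con k(1)] k(2) by simp
  qed
  moreover have "3 \<le> card (verts (segment G v x y))"
  proof -
    have "inj_on v {x..y}" by (rule inj_on_subset[OF inj]) (use x in auto)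
    then show ?thesis unfolding verts_segment[OF x(1,3)] using xy by (simp add: card_image)
  qed
  ultimately show ?thesis using con unfolding two_connected_def by blast
qed

lemma typed_block_segment:
  assumes b: "block x y" and pig: "proper_interval_graph G"
  shows "typed_block (segment G v x y) (y + 1 - x) (\<lambda>k. v (x + k - 1)) \<longleftrightarrow>
    2 \<le> width x y \<and> (\<forall>i. 2 \<le> i \<and> i \<le> width x y - 1 \<longrightarrow>
        R (clique_start x y i - 1) < L (clique_end x y i + 1))"
proof -
  have x: "1 \<le> x" "x < y" "y \<le> n" using b unfolding block_def by auto
  have ccw: "cc (segment G v x y) = width x y" using cc_segment x by simp
  let ?B = "segment G v x y" and ?m = "y + 1 - x" and ?v = "\<lambda>k. v (x + k - 1)"
  have bd: "rightmost ?B ?m ?v (cov_s ?B ?m ?v i - 1) < leftmost ?B ?m ?v (cov_t ?B ?m ?v i + 1) \<longleftrightarrow>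
    R (clique_start x y i - 1) < L (clique_end x y i + 1)" if i: "2 \<le> i" "i \<le> width x y - 1" for i
  proof -
    define s t where "s = clique_start x y i" and "t = clique_end x y i"
    have i': "1 \<le> i" "i \<le> width x y" "i < width x y" using i by auto
    have t: "x < t" "t < y"
      using greedy_gt[OF i(1) b] greedy_less_iff[of x i y] i' x unfolding t_def clique_end_def by auto
    \<comment> \<open>So \<open>x\<close> is not in this clique, and \<open>s - 1\<close> is still a
      position of the block.\<close>
    have Rt: "R x < t"
    proof -
      have "R x < greedy x i"
        using greedy_1[OF b] strict_monoD[OF greedy_strict_mono, of 1 i x] i by simp
      then show ?thesis using clique_end_simps(1)[OF i'(3)] t_def by simp
    qed
    have s: "s = L t" using clique_start_eq[OF b i(1)] s_def t_def by simp
    have xs: "x < s" using adj_iff[of x t] Rt t x unfolding s by auto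
    have sy: "s \<le> t" using L_le[of t] t x unfolding s by simp
    have 1: "cov_s ?B ?m ?v i - 1 = (s - 1) + 1 - x" "cov_t ?B ?m ?v i + 1 = (t + 1) + 1 - x"
      using cov_s_segment[OF b i'(1,2)] cov_t_segment[OF b i'(1,2)] xs t unfolding s_def t_def by auto
    have 2: "rightmost ?B ?m ?v ((s - 1) + 1 - x) = min (R (s - 1)) y + 1 - x"
      by (rule segment_bounds(1)) (use xs sy t x in auto)
    have 3: "leftmost ?B ?m ?v ((t + 1) + 1 - x) = max (L (t + 1)) x + 1 - x"
      by (rule segment_bounds(2)) (use t x in auto)
    have 4: "R (s - 1) \<le> y" by (rule block_R[OF b]) (use xs sy t in auto)
    have 5: "x \<le> L (t + 1)" by (rule block_L[OF b]) (use t in auto)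
    have "s - 1 \<le> R (s - 1)" by (rule R_ge) (use xs sy t x in auto)
    then have 6: "x \<le> R (s - 1)" using xs by linarith
    show ?thesis unfolding 1 2 3 s_def[symmetric] t_def[symmetric] using 4 5 6 by auto
  qed
  \<comment> \<open>Two consecutive vertices form a clique, so covering number 2 forces the three
    vertices that 2-connectedness demands.\<close>
  have "x + 2 \<le> y" if "2 \<le> width x y"
  proof (rule ccontr)
    assume "\<not> x + 2 \<le> y"
    then have "y = x + 1" using x by simp
    then have "y \<le> greedy x 1" using R_gt[of x] x greedy_1[OF b] by simp
    then have "width x y \<le> 1" using le_greedy_iff by blast
    then show False using that by simp
  qed
  then have "two_connected ?B" if "2 \<le> width x y" using two_connected_segment[OF b] that by blast
  moreover have "straight_ordering ?B ?m ?v" using straight_segment x by simp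
  ultimately show ?thesis unfolding typed_block_def ccw
    using proper_interval_segment[OF pig] bd by auto
qed

text \<open>All positions involved are at least \<open>x \<ge> 1\<close>, so the truncated
  subtractions of the re-indexing lose nothing.\<close>

lemma cov_equations:
  assumes b: "block x y" and i: "1 \<le> i" "i + 1 \<le> width x y" and j: "j = i + 1"
  defines "B \<equiv> segment G v x y" and "m \<equiv> y + 1 - x" and "w \<equiv> \<lambda>k. v (x + k - 1)"
  shows "cov_t B m w i = cov_s B m w j \<longleftrightarrow> clique_end x y i = clique_start x y j"
    and "cov_t B m w i = cov_s B m w j - 1 \<longleftrightarrow> clique_end x y i = clique_start x y j - 1"
proof -
  have i': "i \<le> width x y" "1 \<le> j" "j \<le> width x y" using i j by auto
  have "x \<le> clique_end x y i" "x \<le> clique_start x y j" "1 \<le> x"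
    using clique_end_bounds[OF b i(1)] b unfolding clique_start_def block_def by auto
  then show "cov_t B m w i = cov_s B m w j \<longleftrightarrow> clique_end x y i = clique_start x y j"
    "cov_t B m w i = cov_s B m w j - 1 \<longleftrightarrow> clique_end x y i = clique_start x y j - 1"
    unfolding B_def m_def w_def cov_t_segment[OF b i(1) i'(1)] cov_s_segment[OF b i'(2,3)] by auto
qed

end

context connected_straight_graph
begin

text \<open>\<open>E i\<close> and \<open>Q i\<close> say that the cliques \<open>i\<close> and
  \<open>i + 1\<close> are disjoint or share one vertex. Everything but the first and the last
  junction is common to all types, so each type becomes a choice of \<open>E\<close> or
  \<open>Q\<close> at these two. For \<open>k = 2\<close> they are the same junction, whence the
  exceptions.\<close>

lemma types_and_good:
  fixes x y
  assumes b: "block x y" and pig: "proper_interval_graph G"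
  defines "k \<equiv> width x y"
  defines "D \<equiv> 2 \<le> k \<and> (\<forall>i. 2 \<le> i \<and> i \<le> k - 1 \<longrightarrow>
        R (clique_start x y i - 1) < L (clique_end x y i + 1))"
  defines "E \<equiv> \<lambda>i. clique_end x y i = clique_start x y (i + 1) - 1"
    and "Q \<equiv> \<lambda>i. clique_end x y i = clique_start x y (i + 1)"
  defines "M \<equiv> \<forall>i. 2 \<le> i \<and> i \<le> k - 2 \<longrightarrow> E i"
  shows "segment_has type1 G v x y \<longleftrightarrow> D \<and> M \<and> Q 1 \<and> Q (k - 1)"
    and "segment_has type2 G v x y \<longleftrightarrow> D \<and> M \<and> 3 \<le> k \<and> Q 1 \<and> E (k - 1)"
    and "segment_has type3 G v x y \<longleftrightarrow> D \<and> M \<and> 3 \<le> k \<and> E 1 \<and> Q (k - 1)"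
    and "segment_has type4 G v x y \<longleftrightarrow> D \<and> M \<and> E 1 \<and> E (k - 1)"
    and "good x y \<longleftrightarrow> k = 1 \<or> D \<and> M \<and> (E 1 \<or> Q 1 \<and> (x = 1 \<or> k = 2 \<and> y = n)) \<and>
      (E (k - 1) \<or> Q (k - 1) \<and> (k = 2 \<and> x = 1 \<or> y = n))"
proof -
  define B m w where "B = segment G v x y" and "m = y + 1 - x" and "w = (\<lambda>k. v (x + k - 1))"
  have ccw: "cc B = k" using cc_segment[of x y] b unfolding B_def k_def block_def by simp
  have td: "typed_block B m w \<longleftrightarrow> D"
    using typed_block_segment[OF b pig] unfolding B_def m_def w_def D_def k_def .
  have eqQ: "cov_t B m w i = cov_s B m w (i + 1) \<longleftrightarrow> Q i"
    and eqE: "cov_t B m w i = cov_s B m w (i + 1) - 1 \<longleftrightarrow> E i" if "1 \<le> i" "i + 1 \<le> k" for i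
    using cov_equations[OF b that(1) _ refl] that(2) unfolding B_def m_def w_def Q_def E_def k_def by auto
  have last: "cov_t B m w (k - 1) = cov_s B m w k \<longleftrightarrow> Q (k - 1)" if "2 \<le> k"
    using eqQ[of "k - 1"] that by simp
  have first: "cov_t B m w 1 = cov_s B m w 2 \<longleftrightarrow> Q 1" if "2 \<le> k"
    using eqQ[of 1] that by (simp add: numeral_2_eq_2)
  have M': "(\<forall>i. 2 \<le> i \<and> i \<le> k - 2 \<longrightarrow> cov_t B m w i = cov_s B m w (i + 1) - 1) \<longleftrightarrow> M"
    using eqE unfolding M_def by auto
  have split: "(\<forall>i. 1 \<le> i \<and> i \<le> k - 1 \<longrightarrow> P i) \<longleftrightarrow> P 1 \<and> (\<forall>i. 2 \<le> i \<and> i \<le> k - 2 \<longrightarrow> P i) \<and> P (k - 1)"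
    if "2 \<le> k" for P
  proof
    assume a: "P 1 \<and> (\<forall>i. 2 \<le> i \<and> i \<le> k - 2 \<longrightarrow> P i) \<and> P (k - 1)"
    show "\<forall>i. 1 \<le> i \<and> i \<le> k - 1 \<longrightarrow> P i"
    proof (intro allI impI)
      fix i assume "1 \<le> i \<and> i \<le> k - 1"
      then consider "i = 1" | "i = k - 1" | "2 \<le> i \<and> i \<le> k - 2" by linarith
      then show "P i" using a by cases auto
    qed
  next
    assume a: "\<forall>i. 1 \<le> i \<and> i \<le> k - 1 \<longrightarrow> P i"
    have "1 \<le> k - 1" using that by linarith
    moreover have "1 \<le> i \<and> i \<le> k - 1" if "2 \<le> i \<and> i \<le> k - 2" for i using that by linarith
    ultimately show "P 1 \<and> (\<forall>i. 2 \<le> i \<and> i \<le> k - 2 \<longrightarrow> P i) \<and> P (k - 1)" using a by blast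
  qed
  have splitr: "(\<forall>i. 2 \<le> i \<and> i \<le> k - 1 \<longrightarrow> P i) \<longleftrightarrow> (\<forall>i. 2 \<le> i \<and> i \<le> k - 2 \<longrightarrow> P i) \<and> P (k - 1)"
    if "3 \<le> k" for P
  proof -
    have eq: "2 \<le> i \<and> i \<le> k - 1 \<longleftrightarrow> i = k - 1 \<or> 2 \<le> i \<and> i \<le> k - 2" for i using that by linarith
    show ?thesis unfolding eq by blast
  qed
  have splitl: "(\<forall>i. 1 \<le> i \<and> i \<le> k - 2 \<longrightarrow> P i) \<longleftrightarrow> (\<forall>i. 2 \<le> i \<and> i \<le> k - 2 \<longrightarrow> P i) \<and> P 1"
    if "3 \<le> k" for P
  proof -
    have eq: "1 \<le> i \<and> i \<le> k - 2 \<longleftrightarrow> i = 1 \<or> 2 \<le> i \<and> i \<le> k - 2" for i using that by linarith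
    show ?thesis unfolding eq by blast
  qed
  have D2: "D \<Longrightarrow> 2 \<le> k" unfolding D_def by simp
  have E1: "cov_t B m w 1 = cov_s B m w (1 + 1) - 1 \<longleftrightarrow> E 1" if "2 \<le> k" using eqE[of 1] that by simp
  have Ek: "cov_t B m w (k - 1) = cov_s B m w (k - 1 + 1) - 1 \<longleftrightarrow> E (k - 1)" if "2 \<le> k"
    using eqE[of "k - 1"] that by simp
  have 1: "type1 B m w \<longleftrightarrow> D \<and> M \<and> Q 1 \<and> Q (k - 1)"
    unfolding type1_def td ccw M' using first last D2 by blast
  let ?e = "\<lambda>i. cov_t B m w i = cov_s B m w (i + 1) - 1"
  have r: "(\<forall>i. 2 \<le> i \<and> i \<le> k - 1 \<longrightarrow> ?e i) \<longleftrightarrow> M \<and> E (k - 1)" if "3 \<le> k"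
    unfolding splitr[OF that] M' using Ek that by simp
  have l: "(\<forall>i. 1 \<le> i \<and> i \<le> k - 2 \<longrightarrow> ?e i) \<longleftrightarrow> M \<and> E 1" if "3 \<le> k"
    unfolding splitl[OF that] M' using E1 that by simp
  have s: "(\<forall>i. 1 \<le> i \<and> i \<le> k - 1 \<longrightarrow> ?e i) \<longleftrightarrow> E 1 \<and> M \<and> E (k - 1)" if "2 \<le> k"
    unfolding split[OF that] M' using E1 Ek that by simp
  have 2: "type2 B m w \<longleftrightarrow> D \<and> M \<and> 3 \<le> k \<and> Q 1 \<and> E (k - 1)"
    unfolding type2_def td ccw by (cases "3 \<le> k") (use r first D2 in \<open>simp_all add: conj_ac\<close>)
  have 3: "type3 B m w \<longleftrightarrow> D \<and> M \<and> 3 \<le> k \<and> E 1 \<and> Q (k - 1)"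
    unfolding type3_def td ccw by (cases "3 \<le> k") (use l last D2 in \<open>simp_all add: conj_ac\<close>)
  have 4: "type4 B m w \<longleftrightarrow> D \<and> M \<and> E 1 \<and> E (k - 1)"
    unfolding type4_def td ccw
  proof (cases "2 \<le> k")
    case False
    then have "\<not> D" using D2 by blast
    then show "D \<and> (\<forall>i. 1 \<le> i \<and> i \<le> k - 1 \<longrightarrow> ?e i) \<longleftrightarrow> D \<and> M \<and> E 1 \<and> E (k - 1)" by simp
  qed (use s in \<open>simp add: conj_ac\<close>)
  show "segment_has type1 G v x y \<longleftrightarrow> D \<and> M \<and> Q 1 \<and> Q (k - 1)"
    "segment_has type2 G v x y \<longleftrightarrow> D \<and> M \<and> 3 \<le> k \<and> Q 1 \<and> E (k - 1)"
    "segment_has type3 G v x y \<longleftrightarrow> D \<and> M \<and> 3 \<le> k \<and> E 1 \<and> Q (k - 1)"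
    "segment_has type4 G v x y \<longleftrightarrow> D \<and> M \<and> E 1 \<and> E (k - 1)"
    unfolding segment_has_def
    by (rule 1[unfolded B_def m_def w_def] 2[unfolded B_def m_def w_def]
        3[unfolded B_def m_def w_def] 4[unfolded B_def m_def w_def])+
  define P where "P i \<longleftrightarrow> E i \<or> Q i \<and> (i = 1 \<and> x = 1 \<or> i = k - 1 \<and> y = n)" for i
  have g: "good x y \<longleftrightarrow> k = 1 \<or> D \<and> (\<forall>i. 1 \<le> i \<and> i \<le> k - 1 \<longrightarrow> P i)"
    unfolding good_def k_def[symmetric] D_def P_def E_def Q_def by (simp only: conj_assoc)
  have PM: "(\<forall>i. 2 \<le> i \<and> i \<le> k - 2 \<longrightarrow> P i) \<longleftrightarrow> M"
  proof -
    have "P i \<longleftrightarrow> E i" if "2 \<le> i \<and> i \<le> k - 2" for i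
    proof -
      have "i \<noteq> 1" "i \<noteq> k - 1" using that by linarith+
      then show ?thesis unfolding P_def by blast
    qed
    then show ?thesis unfolding M_def by (intro iff_allI imp_cong refl)
  qed
  have "2 \<le> k \<Longrightarrow> 1 = k - 1 \<longleftrightarrow> k = 2" "2 \<le> k \<Longrightarrow> k - 1 = 1 \<longleftrightarrow> k = 2" by linarith+
  then have P1: "2 \<le> k \<Longrightarrow> P 1 \<longleftrightarrow> E 1 \<or> Q 1 \<and> (x = 1 \<or> k = 2 \<and> y = n)"
    "2 \<le> k \<Longrightarrow> P (k - 1) \<longleftrightarrow> E (k - 1) \<or> Q (k - 1) \<and> (k = 2 \<and> x = 1 \<or> y = n)"
    unfolding P_def by simp_all
  show "good x y \<longleftrightarrow> k = 1 \<or> D \<and> M \<and> (E 1 \<or> Q 1 \<and> (x = 1 \<or> k = 2 \<and> y = n)) \<and>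
      (E (k - 1) \<or> Q (k - 1) \<and> (k = 2 \<and> x = 1 \<or> y = n))"
    unfolding g
  proof (cases "2 \<le> k")
    case True
    show "k = 1 \<or> D \<and> (\<forall>i. 1 \<le> i \<and> i \<le> k - 1 \<longrightarrow> P i) \<longleftrightarrow>
      k = 1 \<or> D \<and> M \<and> (E 1 \<or> Q 1 \<and> (x = 1 \<or> k = 2 \<and> y = n)) \<and>
      (E (k - 1) \<or> Q (k - 1) \<and> (k = 2 \<and> x = 1 \<or> y = n))"
      unfolding split[OF True] PM P1[OF True] by (simp only: conj_ac)
  next
    case False
    then have "\<not> D" using D2 by blast
    then show "k = 1 \<or> D \<and> (\<forall>i. 1 \<le> i \<and> i \<le> k - 1 \<longrightarrow> P i) \<longleftrightarrow>
      k = 1 \<or> D \<and> M \<and> (E 1 \<or> Q 1 \<and> (x = 1 \<or> k = 2 \<and> y = n)) \<and>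
      (E (k - 1) \<or> Q (k - 1) \<and> (k = 2 \<and> x = 1 \<or> y = n))" by simp
  qed
qed

text \<open>The cases record which ends of the block are ends of the graph, hence where overlaps are
  permitted. With two cliques the only junction belongs to both ends, so an overlap allowed at
  either end gives type 1 with \<open>cc\<close> equal to 2.\<close>

lemma good_iff:
  assumes b: "block x y" and pig: "proper_interval_graph G"
  shows "x = 1 \<Longrightarrow> y = n \<Longrightarrow> good x y \<longleftrightarrow> cc (segment G v x y) = 1 \<or> segment_has type1 G v x y \<or>
      segment_has type2 G v x y \<or> segment_has type3 G v x y \<or> segment_has type4 G v x y"
    and "x = 1 \<Longrightarrow> y \<noteq> n \<Longrightarrow> good x y \<longleftrightarrow> cc (segment G v x y) = 1 \<or>
      (cc (segment G v x y) = 2 \<and> segment_has type1 G v x y) \<or>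
      segment_has type2 G v x y \<or> segment_has type4 G v x y"
    and "x \<noteq> 1 \<Longrightarrow> y = n \<Longrightarrow> good x y \<longleftrightarrow> cc (segment G v x y) = 1 \<or>
      (cc (segment G v x y) = 2 \<and> segment_has type1 G v x y) \<or>
      segment_has type3 G v x y \<or> segment_has type4 G v x y"
    and "x \<noteq> 1 \<Longrightarrow> y \<noteq> n \<Longrightarrow> good x y \<longleftrightarrow> cc (segment G v x y) = 1 \<or> segment_has type4 G v x y"
proof -
  have ccw: "cc (segment G v x y) = width x y" using cc_segment[of x y] b unfolding block_def by simp
  have k: "width x y = 2 \<Longrightarrow> width x y - 1 = 1" "3 \<le> width x y \<longleftrightarrow> 2 \<le> width x y \<and> width x y \<noteq> 2"
    by auto
  note t = types_and_good[OF b pig]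
  show "x = 1 \<Longrightarrow> y = n \<Longrightarrow> good x y \<longleftrightarrow> cc (segment G v x y) = 1 \<or> segment_has type1 G v x y \<or>
      segment_has type2 G v x y \<or> segment_has type3 G v x y \<or> segment_has type4 G v x y"
    unfolding t ccw k(2) by (cases "width x y = 2") (use k(1) in \<open>simp_all only:\<close>, blast+)
  show "x = 1 \<Longrightarrow> y \<noteq> n \<Longrightarrow> good x y \<longleftrightarrow> cc (segment G v x y) = 1 \<or>
      (cc (segment G v x y) = 2 \<and> segment_has type1 G v x y) \<or>
      segment_has type2 G v x y \<or> segment_has type4 G v x y"
    unfolding t ccw k(2) by (cases "width x y = 2") (use k(1) in \<open>simp_all only:\<close>, blast+)
  show "x \<noteq> 1 \<Longrightarrow> y = n \<Longrightarrow> good x y \<longleftrightarrow> cc (segment G v x y) = 1 \<or>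
      (cc (segment G v x y) = 2 \<and> segment_has type1 G v x y) \<or>
      segment_has type3 G v x y \<or> segment_has type4 G v x y"
    unfolding t ccw k(2) by (cases "width x y = 2") (use k(1) in \<open>simp_all only:\<close>, blast+)
  show "x \<noteq> 1 \<Longrightarrow> y \<noteq> n \<Longrightarrow> good x y \<longleftrightarrow> cc (segment G v x y) = 1 \<or> segment_has type4 G v x y"
    unfolding t ccw k(2) by (cases "width x y = 2") (use k(1) in \<open>simp_all only:\<close>, blast+)
qed

lemma cutvertices_eq: "{x \<in> verts G. cutvertex G x} = v ` {x. cut x}"
proof
  show "{x \<in> verts G. cutvertex G x} \<subseteq> v ` {x. cut x}"
    using cutvertex_iff[OF connected] unfolding verts_eq by blast
  have "x \<in> {1..n}" if "cut x" for x using that unfolding cut_def by simp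
  then show "v ` {x. cut x} \<subseteq> {x \<in> verts G. cutvertex G x}"
    using cutvertex_iff[OF connected] unfolding verts_eq by blast
qed

lemma block_iff_consecutive:
  fixes c :: nat and j :: "nat \<Rightarrow> nat"
  assumes c: "1 \<le> c" and j: "strict_mono_on {1..c} j" and cuts: "{x. cut x} = j ` {1..c}"
  shows "block x y \<longleftrightarrow> x = 1 \<and> y = j 1 \<or> x = j c \<and> y = n \<or>
    (\<exists>i. 1 \<le> i \<and> i \<le> c - 1 \<and> x = j i \<and> y = j (i + 1))"
proof -
  have less: "j a < j b \<longleftrightarrow> a < b" and le: "j a \<le> j b \<longleftrightarrow> a \<le> b" if "1 \<le> a" "a \<le> c" "1 \<le> b" "b \<le> c" for a b
    using strict_mono_on_less[OF j] strict_mono_on_less_eq[OF j] that by simp_all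
  have cut_j: "cut (j a)" if "1 \<le> a" "a \<le> c" for a using cuts that by auto
  have cutE: "\<exists>a. 1 \<le> a \<and> a \<le> c \<and> z = j a" if "cut z" for z
  proof -
    have "z \<in> j ` {1..c}" using cuts that by blast
    then show ?thesis by auto
  qed
  have cb: "1 < z \<and> z < n" if "cut z" for z using that unfolding cut_def by simp
  have jb: "1 < j a" "j a < n" if "1 \<le> a" "a \<le> c" for a using cb[OF cut_j[OF that]] by auto
  show ?thesis
  proof
    assume b: "block x y"
    then have bb: "1 \<le> x" "x < y" "y \<le> n" "x = 1 \<or> cut x" "y = n \<or> cut y"
      and nc: "\<And>z. x < z \<Longrightarrow> z < y \<Longrightarrow> \<not> cut z" unfolding block_def by auto
    show "x = 1 \<and> y = j 1 \<or> x = j c \<and> y = n \<or> (\<exists>i. 1 \<le> i \<and> i \<le> c - 1 \<and> x = j i \<and> y = j (i + 1))"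
    proof (cases "x = 1")
      case True
      \<comment> \<open>Otherwise the cut \<open>j 1\<close> would lie strictly inside the
        block.\<close>
      have "y \<le> j 1" using nc[of "j 1"] jb(1)[of 1] cut_j[of 1] c True by force
      then have "y \<noteq> n" using jb(2)[of 1] c by force
      then obtain a where a: "1 \<le> a" "a \<le> c" "y = j a" using bb cutE by blast
      then have "a = 1" using le[of a 1] \<open>y \<le> j 1\<close> c by simp
      then show ?thesis using True a by blast
    next
      case False
      then obtain i where i: "1 \<le> i" "i \<le> c" "x = j i" using bb cutE by blast
      show ?thesis
      proof (cases "i = c")
        case True
        have "\<not> cut y"
        proof
          assume "cut y"
          then obtain a where a: "1 \<le> a" "a \<le> c" "y = j a" using cutE by blast
          then show False using less[of i a] i bb True by simp
        qed
        then show ?thesis using True i bb by blast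
      next
        case False
        then have i1: "1 \<le> i + 1" "i + 1 \<le> c" using i by auto
        have "x < j (i + 1)" using less[of i "i + 1"] i i1 by simp
        then have "y \<le> j (i + 1)" using nc[of "j (i + 1)"] cut_j[OF i1] by force
        then have "y \<noteq> n" using jb(2)[OF i1] by force
        then obtain a where a: "1 \<le> a" "a \<le> c" "y = j a" using bb cutE by blast
        have "a \<le> i + 1" using le[OF a(1,2) i1] \<open>y \<le> j (i + 1)\<close> a by simp
        moreover have "i < a" using less[OF i(1,2) a(1,2)] bb(2) a i by simp
        ultimately have "a = i + 1" by simp
        then show ?thesis using i i1 a by (intro disjI2 exI[of _ i]) auto
      qed
    qed
  next
    have no_cut: "\<not> cut z" if "\<And>a. 1 \<le> a \<Longrightarrow> a \<le> c \<Longrightarrow> z \<noteq> j a" for z using cutE that by blast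
    assume "x = 1 \<and> y = j 1 \<or> x = j c \<and> y = n \<or> (\<exists>i. 1 \<le> i \<and> i \<le> c - 1 \<and> x = j i \<and> y = j (i + 1))"
    then consider "x = 1" "y = j 1" | "x = j c" "y = n" | i where "1 \<le> i" "i \<le> c - 1" "x = j i" "y = j (i + 1)"
      by blast
    then show "block x y"
    proof cases
      case 1
      have "\<not> cut z" if "z < j 1" for z
      proof (rule no_cut)
        fix a assume a: "1 \<le> a" "a \<le> c"
        show "z \<noteq> j a" using le[of 1 a] a c that by force
      qed
      then show ?thesis using 1 jb[of 1] cut_j[of 1] c unfolding block_def by auto
    next
      case 2
      have "\<not> cut z" if "j c < z" for z
      proof (rule no_cut)
        fix a assume a: "1 \<le> a" "a \<le> c"
        show "z \<noteq> j a" using le[of a c] a c that by force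
      qed
      then show ?thesis using 2 jb[of c] cut_j[of c] c unfolding block_def by auto
    next
      case 3
      then have i: "1 \<le> i" "i \<le> c" "1 \<le> i + 1" "i + 1 \<le> c" by auto
      have "\<not> cut z" if "j i < z" "z < j (i + 1)" for z
      proof (rule no_cut)
        fix a assume a: "1 \<le> a" "a \<le> c"
        have "\<not> (i < a \<and> a < i + 1)" by simp
        then show "z \<noteq> j a" using less[OF i(1,2) a] less[OF a i(3,4)] that by blast
      qed
      then show ?thesis
        using 3 jb[OF i(1,2)] jb[OF i(3,4)] cut_j[OF i(1,2)] cut_j[OF i(3,4)] less[OF i] unfolding block_def by auto
    qed
  qed
qed

end

section \<open>Enumerating the cutvertices and assembling the blocks\<close>

lemma enumerate_finite_nat_set:
  fixes C :: "nat set"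
  assumes "finite C"
  obtains j :: "nat \<Rightarrow> nat" where "strict_mono_on {1..card C} j" "j ` {1..card C} = C"
proof -
  define l where "l = sorted_list_of_set C"
  have l: "length l = card C" "set l = C" "sorted_wrt (<) l" using assms unfolding l_def by auto
  define j where "j i = l ! (i - 1)" for i
  have "strict_mono_on {1..card C} j"
  proof (rule strict_mono_onI)
    fix a b assume "a \<in> {1..card C}" "b \<in> {1..card C}" "a < b"
    then have "a - 1 < b - 1" "b - 1 < length l" using l(1) by auto
    then show "j a < j b" unfolding j_def using sorted_wrt_nth_less[OF l(3)] by blast
  qed
  moreover have "j ` {1..card C} = C"
  proof
    show "j ` {1..card C} \<subseteq> C"
    proof
      fix z assume "z \<in> j ` {1..card C}"
      then obtain i where "i \<in> {1..card C}" "z = l ! (i - 1)" unfolding j_def by blast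
      moreover from this(1) have "i - 1 < length l" using l(1) by auto
      ultimately show "z \<in> C" using nth_mem l(2) by metis
    qed
    show "C \<subseteq> j ` {1..card C}"
    proof
      fix z assume "z \<in> C"
      then obtain i where "i < length l" "z = l ! i" using l(2) by (metis in_set_conv_nth)
      then have "z = j (i + 1)" "i + 1 \<in> {1..card C}" using l(1) unfolding j_def by auto
      then show "z \<in> j ` {1..card C}" by blast
    qed
  qed
  ultimately show thesis using that by blast
qed

theorem theorem20:
  fixes G :: "'a graph" and n :: nat and v :: "nat \<Rightarrow> 'a"
  assumes "simple_graph G"
    and "connected_graph G"
    and "reduced_graph G"
    and "proper_interval_graph G"
    and "straight_ordering G n v"
  shows "(\<exists>col. locally_complete_colouring G col) \<longleftrightarrow>
    ((\<forall>x\<in>verts G. \<not> cutvertex G x) \<and>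
      (cc G = 1 \<or> type1 G n v \<or> type2 G n v \<or> type3 G n v \<or> type4 G n v))
    \<or>
    (\<exists>(c::nat) (j :: nat \<Rightarrow> nat).
      c \<ge> 1 \<and> 1 < j 1 \<and> strict_mono_on {1..c} j \<and> j c < n \<and>
      {x \<in> verts G. cutvertex G x} = (\<lambda>i. v (j i)) ` {1..c} \<and>
      (cc (segment G v 1 (j 1)) = 1
        \<or> (cc (segment G v 1 (j 1)) = 2 \<and> segment_has type1 G v 1 (j 1))
        \<or> segment_has type2 G v 1 (j 1)
        \<or> segment_has type4 G v 1 (j 1)) \<and>
      (cc (segment G v (j c) n) = 1
        \<or> (cc (segment G v (j c) n) = 2 \<and> segment_has type1 G v (j c) n)
        \<or> segment_has type3 G v (j c) n
        \<or> segment_has type4 G v (j c) n) \<and>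
      (\<forall>i. 1 \<le> i \<and> i \<le> c - 1 \<longrightarrow>
        cc (segment G v (j i) (j (i + 1))) = 1
        \<or> segment_has type4 G v (j i) (j (i + 1))))"
    (is "?col \<longleftrightarrow> ?A \<or> (\<exists>c j. ?B c j)")
proof -
  have "1 \<le> n"
    using assms(2,5) unfolding connected_graph_def straight_ordering_def bij_betw_def by (cases n) auto
  then interpret connected_straight_graph G n v
    using assms by unfold_locales auto
  interpret reduced_straight_order n R L using reduced_straight_order[OF assms(3)] .
  note pig = assms(4)
  have col: "?col \<longleftrightarrow> (\<forall>x y. block x y \<longrightarrow> good x y)"
    unfolding colouring_iff_alternating alternating_iff_good ..
  have all: "segment G v 1 n = G" unfolding segment_def by (rule induced_all)
  \<comment> \<open>For an increasing enumeration of the cut positions, the conditions in the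
    statement run through the blocks one by one.\<close>
  have B: "?B c j \<longleftrightarrow> (\<forall>x y. block x y \<longrightarrow> good x y)"
    if cj: "1 \<le> c" "strict_mono_on {1..c} j" "{x. cut x} = j ` {1..c}" for c j
  proof -
    have cut_j: "1 < j i \<and> j i < n" if "1 \<le> i" "i \<le> c" for i
    proof -
      have "cut (j i)" using cj(3) that by auto
      then show ?thesis unfolding cut_def by simp
    qed
    have j1: "1 < j 1" "j 1 < n" "1 < j c" "j c < n" using cut_j[of 1] cut_j[of c] cj(1) by auto
    note bl = block_iff_consecutive[OF cj]
    have b1: "block 1 (j 1)" and bc: "block (j c) n"
      and bi: "\<And>i. 1 \<le> i \<Longrightarrow> i \<le> c - 1 \<Longrightarrow> block (j i) (j (i + 1))"
      unfolding bl by blast+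
    have ji: "j i \<noteq> 1 \<and> j (i + 1) \<noteq> n" if "1 \<le> i" "i \<le> c - 1" for i
    proof -
      have "i \<le> c" "1 \<le> i + 1" "i + 1 \<le> c" using that by linarith+
      then show ?thesis using cut_j[of i] cut_j[of "i + 1"] that by auto
    qed
    have "(\<forall>x y. block x y \<longrightarrow> good x y) \<longleftrightarrow> good 1 (j 1) \<and> good (j c) n \<and>
        (\<forall>i. 1 \<le> i \<and> i \<le> c - 1 \<longrightarrow> good (j i) (j (i + 1)))"
      unfolding bl by blast
    also have "\<dots> \<longleftrightarrow> ?B c j"
    proof -
      have "(\<lambda>i. v (j i)) ` {1..c} = v ` j ` {1..c}" by (simp add: image_image)
      then have "{x \<in> verts G. cutvertex G x} = (\<lambda>i. v (j i)) ` {1..c}"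
        unfolding cutvertices_eq cj(3) by simp
      moreover note good_iff(2)[OF b1 pig refl] good_iff(3)[OF bc pig]
      moreover have "(\<forall>i. 1 \<le> i \<and> i \<le> c - 1 \<longrightarrow> good (j i) (j (i + 1))) \<longleftrightarrow>
        (\<forall>i. 1 \<le> i \<and> i \<le> c - 1 \<longrightarrow> cc (segment G v (j i) (j (i + 1))) = 1
          \<or> segment_has type4 G v (j i) (j (i + 1)))"
        using good_iff(4)[OF bi pig] ji by blast
      moreover have "j 1 \<noteq> n" "j c \<noteq> 1" using j1 by auto
      ultimately show ?thesis using cj(1,2) j1 by simp
    qed
    finally show ?thesis by simp
  qed
  have fin: "finite {x. cut x}" by (rule finite_subset[of _ "{..n}"]) (auto simp: cut_def)
  show ?thesis
  proof (cases "{x. cut x} = {}")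
    case True
    have nc: "\<forall>x\<in>verts G. \<not> cutvertex G x" using cutvertices_eq unfolding True by blast
    have notB: "\<not> ?B c j" for c j
    proof
      assume "?B c j"
      then have "1 \<le> c" "(\<lambda>i. v (j i)) ` {1..c} = {}" using cutvertices_eq unfolding True by auto
      then show False by simp
    qed
    \<comment> \<open>For \<open>n = 1\<close> there is no block, and the right-hand side holds
      because \<open>cc G = 1\<close>.\<close>
    have bl: "block x y \<longleftrightarrow> x = 1 \<and> y = n \<and> 1 < n" for x y using True unfolding block_def by auto
    have "(\<forall>x y. block x y \<longrightarrow> good x y) \<longleftrightarrow>
      cc G = 1 \<or> type1 G n v \<or> type2 G n v \<or> type3 G n v \<or> type4 G n v"
    proof (cases "1 < n")
      case True
      have "segment_has P G v 1 n \<longleftrightarrow> P G n v" for P unfolding segment_has_def all by simp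
      then show ?thesis using good_iff(1)[of 1 n] bl True pig unfolding all by auto
    next
      case False
      then have "n = 1" using pos by simp
      have "1 \<le> greedy 1 1" using greedy_less[of 1 0] unfolding One_nat_def by linarith
      then have "width 1 n \<le> 1" "1 \<le> width 1 n" using le_greedy_iff[of n 1 1] width_pos[of 1 n] \<open>n = 1\<close> by auto
      then have "cc G = 1" using cc_segment[of 1 n] pos unfolding all by simp
      then show ?thesis using bl False by simp
    qed
    then show ?thesis using col nc notB by blast
  next
    case False
    then have notA: "\<not> ?A" using cutvertices_eq by blast
    have colB: "?col" if "?B c j" for c j
    proof -
      have m: "1 \<le> c" "strict_mono_on {1..c} j" "1 < j 1" "j c < n"
        "{x \<in> verts G. cutvertex G x} = (\<lambda>i. v (j i)) ` {1..c}" using that by blast+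
      \<comment> \<open>The statement determines the cutvertices only as a set of vertices;
        recovering their positions by injectivity of \<open>v\<close> requires that \<open>j\<close>
        stays in \<open>{1..n}\<close>.\<close>
      have "j i \<in> {1..n}" if "i \<in> {1..c}" for i
      proof -
        have "j 1 \<le> j i" "j i \<le> j c" using strict_mono_on_leD[OF m(2)] that by auto
        then show ?thesis using m(3,4) by simp
      qed
      then have sub: "j ` {1..c} \<subseteq> {1..n}" by blast
      have "{x. cut x} \<subseteq> {1..n}" unfolding cut_def by auto
      moreover have "v ` {x. cut x} = v ` j ` {1..c}"
        using m(5) unfolding cutvertices_eq by (simp add: image_image)
      ultimately have "{x. cut x} = j ` {1..c}" using inj_on_image_eq_iff[OF inj _ sub] by blast
      then show ?col using B[OF m(1,2)] that col by blast
    qed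
    have Bcol: "\<exists>c j. ?B c j" if ?col
    proof -
      obtain j where j: "strict_mono_on {1..card {x. cut x}} j" "j ` {1..card {x. cut x}} = {x. cut x}"
        using enumerate_finite_nat_set[OF fin] .
      have "1 \<le> card {x. cut x}" using False fin by (simp add: Suc_le_eq card_gt_0_iff)
      then have "?B (card {x. cut x}) j" using B[OF _ j(1) j(2)[symmetric]] col that by blast
      then show ?thesis by blast
    qed
    show ?thesis
    proof
      assume ?col
      then show "?A \<or> (\<exists>c j. ?B c j)" by (rule disjI2[OF Bcol])
    next
      assume "?A \<or> (\<exists>c j. ?B c j)"
      then show ?col
      proof (elim disjE exE)
        assume ?A
        then show ?col by (rule notE[OF notA])
      next
        fix c j assume "?B c j"
        then show ?col by (rule colB)
      qed
    qed
  qed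
qed

end
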